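(* Let $k$ be a positive integer. Let $(G,\sigma)$ be a $(2k+1)$-unbalanced, $(12k-1)$-edge connected signed graph. Then for every mapping $\beta:V(G)\to\mathbb{Z}_{2k+1}$, the signed graph $(G,\sigma)$ has a $\beta$-orientation.
   Context: A signed graph is a pair $(G,\sigma)$ where $G$ is a graph and $\sigma:E(G)\to\{1,-1\}$; edges with $\sigma(e)=1$ are positive, those with $\sigma(e)=-1$ negative. An orientation $\tau$ of $(G,\sigma)$ orients each positive edge $e=xy$ from one end to the other (if from $x$ to $y$, then $e\in E^+_\tau(x)\cap E^-_\tau(y)$), and labels each negative edge $e=xy$ either as a sink edge, with $e\in E^+_\tau(x)\cap E^+_\tau(y)$, or as a source edge, with $e\in E^-_\tau(x)\cap E^-_\tau(y)$. Write $d^+_\tau(x)=|E^+_\tau(x)|$ and $d^-_\tau(x)=|E^-_\tau(x)|$. Given $\beta:V(G)\to\mathbb{Z}_{2k+1}$, a $\beta$-orientation is an orientation $\tau$ with $d^+_\tau(x)-d^-_\tau(x)\equiv\beta(x)\pmod{2k+1}$ for every vertex $x$. Switching at a vertex $v$ negates the sign of every edge incident to $v$. Two signed graphs on the same underlying graph are equivalent if one is obtained from the other by a sequence of switchings. $(G,\sigma)$ is $(2k+1)$-unbalanced if every signed graph equivalent to it has at least $2k+1$ negative edges. Edge connectivity refers to $G$. *)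

theory Defs
  imports Main "HOL-Number_Theory.Cong"
begin

definition multigraph :: "'v set \<Rightarrow> 'e set \<Rightarrow> ('e \<Rightarrow> 'v set) \<Rightarrow> bool" where
  "multigraph V E ends \<longleftrightarrow> finite V \<and> finite E \<and>
     (\<forall>e\<in>E. card (ends e) = 2 \<and> ends e \<subseteq> V)"

definition edge_cut :: "'e set \<Rightarrow> ('e \<Rightarrow> 'v set) \<Rightarrow> 'v set \<Rightarrow> 'e set" where
  "edge_cut E ends X = {e\<in>E. card (ends e \<inter> X) = 1}"

definition edge_connected :: "nat \<Rightarrow> 'v set \<Rightarrow> 'e set \<Rightarrow> ('e \<Rightarrow> 'v set) \<Rightarrow> bool" where
  "edge_connected l V E ends \<longleftrightarrow>
     (\<forall>X. X \<subseteq> V \<and> X \<noteq> {} \<and> X \<noteq> V \<longrightarrow> card (edge_cut E ends X) \<ge> l)"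

text \<open>Signatures: sigma e = True means e is negative (sign -1).\<close>
definition switch_at :: "('e \<Rightarrow> 'v set) \<Rightarrow> 'v \<Rightarrow> ('e \<Rightarrow> bool) \<Rightarrow> ('e \<Rightarrow> bool)" where
  "switch_at ends v \<sigma> = (\<lambda>e. if v \<in> ends e then \<not> \<sigma> e else \<sigma> e)"

definition switch_step :: "'v set \<Rightarrow> ('e \<Rightarrow> 'v set) \<Rightarrow> ('e \<Rightarrow> bool) \<Rightarrow> ('e \<Rightarrow> bool) \<Rightarrow> bool" where
  "switch_step V ends \<sigma> \<sigma>' \<longleftrightarrow> (\<exists>v\<in>V. \<sigma>' = switch_at ends v \<sigma>)"

definition sig_equivalent :: "'v set \<Rightarrow> ('e \<Rightarrow> 'v set) \<Rightarrow> ('e \<Rightarrow> bool) \<Rightarrow> ('e \<Rightarrow> bool) \<Rightarrow> bool" where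
  "sig_equivalent V ends = (switch_step V ends)\<^sup>*\<^sup>*"

definition num_negative :: "'e set \<Rightarrow> ('e \<Rightarrow> bool) \<Rightarrow> nat" where
  "num_negative E \<sigma> = card {e\<in>E. \<sigma> e}"

definition unbalanced :: "nat \<Rightarrow> 'v set \<Rightarrow> 'e set \<Rightarrow> ('e \<Rightarrow> 'v set) \<Rightarrow> ('e \<Rightarrow> bool) \<Rightarrow> bool" where
  "unbalanced m V E ends \<sigma> \<longleftrightarrow>
     (\<forall>\<sigma>'. sig_equivalent V ends \<sigma> \<sigma>' \<longrightarrow> num_negative E \<sigma>' \<ge> m)"

text \<open>An orientation: tau e x = True means e \<in> E^+(x) (x an end of e), False means e \<in> E^-(x).
  A positive edge is directed from one end to the other (exactly one end has it in E^+);
  a negative edge is a sink edge (both ends E^+) or a source edge (both ends E^-).\<close>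
definition orientation :: "'e set \<Rightarrow> ('e \<Rightarrow> 'v set) \<Rightarrow> ('e \<Rightarrow> bool) \<Rightarrow> ('e \<Rightarrow> 'v \<Rightarrow> bool) \<Rightarrow> bool" where
  "orientation E ends \<sigma> \<tau> \<longleftrightarrow>
     (\<forall>e\<in>E. \<forall>x\<in>ends e. \<forall>y\<in>ends e. x \<noteq> y \<longrightarrow>
        (if \<sigma> e then \<tau> e x = \<tau> e y else \<tau> e x \<noteq> \<tau> e y))"

definition out_deg :: "'e set \<Rightarrow> ('e \<Rightarrow> 'v set) \<Rightarrow> ('e \<Rightarrow> 'v \<Rightarrow> bool) \<Rightarrow> 'v \<Rightarrow> nat" where
  "out_deg E ends \<tau> x = card {e\<in>E. x \<in> ends e \<and> \<tau> e x}"

definition in_deg :: "'e set \<Rightarrow> ('e \<Rightarrow> 'v set) \<Rightarrow> ('e \<Rightarrow> 'v \<Rightarrow> bool) \<Rightarrow> 'v \<Rightarrow> nat" where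
  "in_deg E ends \<tau> x = card {e\<in>E. x \<in> ends e \<and> \<not> \<tau> e x}"

definition beta_orientation :: "int \<Rightarrow> 'v set \<Rightarrow> 'e set \<Rightarrow> ('e \<Rightarrow> 'v set) \<Rightarrow> ('e \<Rightarrow> bool)
     \<Rightarrow> ('v \<Rightarrow> int) \<Rightarrow> ('e \<Rightarrow> 'v \<Rightarrow> bool) \<Rightarrow> bool" where
  "beta_orientation m V E ends \<sigma> \<beta> \<tau> \<longleftrightarrow> orientation E ends \<sigma> \<tau> \<and>
     (\<forall>x\<in>V. [int (out_deg E ends \<tau> x) - int (in_deg E ends \<tau> x) = \<beta> x] (mod m))"

end

theory Submission
  imports Defs
begin

text \<open>
  Among the signatures equivalent to \<open>\<sigma>\<close> take one with the fewest negative edges. Switching a set \<open>X\<close>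
  shows that at most half of the edges of each cut are negative, so the positive edges form a
  \<open>6k\<close>-edge-connected graph. Directing the at least \<open>2k+1\<close> negative edges as sinks or sources, the total
  of the remaining boundary can be made \<open>0\<close> modulo \<open>2k+1\<close>, and the theorem of Lovasz, Thomassen, Wu
  and Zhang on modulo orientations orients the positive edges.

  That theorem is proved for graphs with some edges at an extra vertex \<open>z\<close> preoriented. A minimal
  counterexample has no nontrivial tight cut (contract one side, then the other). Hence two edges at a
  vertex can be lifted whenever its degree is not tight or its demand is \<open>0\<close>, so that all vertices are
  tight with nonzero demand. An edge between vertices with demands of opposite sign can be directed and
  deleted, which leaves the case that all demands are positive and all edges at \<open>z\<close> leave \<open>z\<close>. Then
  adding edges from some \<open>x\<close> to \<open>z\<close> raises the demand of \<open>x\<close> to \<open>2k+1\<close>, which is congruent to \<open>-(2k+1)\<close>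
  modulo \<open>4k+2\<close>, and again an edge can be deleted.
\<close>

section \<open>Distance to the multiples of an integer\<close>

definition cdist :: "int \<Rightarrow> int \<Rightarrow> int" where
  "cdist M x = min (x mod M) (M - x mod M)"

lemma cdist_cong:
  assumes "M dvd x - y"
  shows "cdist M x = cdist M y"
proof -
  have "x mod M = y mod M" using assms by (simp add: mod_eq_dvd_iff)
  then show ?thesis unfolding cdist_def by simp
qed

text \<open>One of \<open>x mod M\<close> and \<open>x mod M - M\<close> has absolute value
  \<open>cdist M x\<close>. Together with \<open>cdist_le_rep\<close> this turns claims about
  \<open>cdist\<close> into claims about a representative of least absolute value.\<close>

lemma cdist_rep:
  assumes "M > 0"
  obtains g where "M dvd x - g" "\<bar>g\<bar> = cdist M x"
proof (cases "x mod M \<le> M - x mod M")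
  case True
  show ?thesis
  proof (rule that[of "x mod M"])
    show "M dvd x - x mod M" by (simp add: dvd_minus_mod)
    show "\<bar>x mod M\<bar> = cdist M x" using True assms unfolding cdist_def by simp
  qed
next
  case False
  show ?thesis
  proof (rule that[of "x mod M - M"])
    have "x - (x mod M - M) = (x - x mod M) + M" by simp
    then show "M dvd x - (x mod M - M)" by (metis dvd_add dvd_minus_mod dvd_refl)
    show "\<bar>x mod M - M\<bar> = cdist M x" using False pos_mod_bound[OF assms, of x] unfolding cdist_def by linarith
  qed
qed

lemma cdist_le_abs:
  assumes "M > 0"
  shows "cdist M x \<le> \<bar>x\<bar>"
proof (cases "x \<ge> 0")
  case True
  then have "x mod M \<le> x" using assms by (simp add: zmod_le_nonneg_dividend)
  then show ?thesis using True unfolding cdist_def by simp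
next
  case False
  have "(- x) mod M \<le> - x" using False assms by (simp add: zmod_le_nonneg_dividend)
  moreover have "(-x) mod M = (if x mod M = 0 then 0 else M - x mod M)"
    by (rule zmod_zminus1_eq_if)
  ultimately show ?thesis using False unfolding cdist_def by (auto split: if_splits)
qed

lemma cdist_nonneg: "M > 0 \<Longrightarrow> cdist M x \<ge> 0"
  using pos_mod_bound[of M x] pos_mod_sign[of M x] unfolding cdist_def by linarith

lemma cdist_le_half: "M > 0 \<Longrightarrow> 2 * cdist M x \<le> M"
  unfolding cdist_def by (simp add: min_def)

lemma cdist_le_rep:
  assumes "M > 0" "M dvd x - y"
  shows "cdist M x \<le> \<bar>y\<bar>"
  using cdist_cong[OF assms(2)] cdist_le_abs[OF assms(1), of y] by simp

lemma cdist_add: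
  assumes "M > 0"
  shows "cdist M (x + y) \<le> cdist M x + cdist M y"
proof -
  obtain g where g: "M dvd x - g" "\<bar>g\<bar> = cdist M x" using cdist_rep[OF assms] .
  obtain h where h: "M dvd y - h" "\<bar>h\<bar> = cdist M y" using cdist_rep[OF assms] .
  have "M dvd (x + y) - (g + h)" using dvd_add[OF g(1) h(1)] by (simp add: algebra_simps)
  then have "cdist M (x + y) \<le> \<bar>g + h\<bar>" by (rule cdist_le_rep[OF assms])
  then show ?thesis using g h by linarith
qed

lemma cdist_add_le: "M > 0 \<Longrightarrow> cdist M (x + y) \<le> cdist M x + \<bar>y\<bar>"
  using cdist_add[of M x y] cdist_le_abs[of M y] by linarith

lemma cdist_minus:
  assumes "M > 0"
  shows "cdist M (- x) = cdist M x"
proof -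
  have le: "cdist M (- x) \<le> cdist M x" for x
  proof -
    obtain g where g: "M dvd x - g" "\<bar>g\<bar> = cdist M x" using cdist_rep[OF assms] .
    have "M dvd - x - (- g)" using g(1) by (simp add: dvd_diff_commute)
    from cdist_le_rep[OF assms this] show ?thesis using g(2) by simp
  qed
  from le[of x] le[of "-x"] show ?thesis by simp
qed

lemma cdist_eq_0_iff:
  assumes "M > 0"
  shows "cdist M x = 0 \<longleftrightarrow> M dvd x"
  using pos_mod_bound[OF assms, of x] unfolding cdist_def by (auto simp: min_def dvd_eq_mod_eq_0)

text \<open>Congruence modulo an even number preserves parity. Through this the parity condition in
  \<open>admissible\<close> forces a load above its lower bound to exceed that bound by at least
  \<open>2\<close>.\<close>

lemma even_cdist:
  assumes "M > 0" "even M"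
  shows "even (cdist M x) \<longleftrightarrow> even x"
proof -
  obtain g where g: "M dvd x - g" "\<bar>g\<bar> = cdist M x" using cdist_rep[OF assms(1)] .
  have "even (x - g)" using g(1) assms(2) dvd_trans by blast
  then show ?thesis using g(2)[symmetric] by simp
qed

section \<open>Graphs with preoriented edges\<close>

definition cut_size :: "'e set \<Rightarrow> ('e \<Rightarrow> 'v) \<Rightarrow> ('e \<Rightarrow> 'v) \<Rightarrow> 'v set \<Rightarrow> int" where
  "cut_size E s t A = (\<Sum>e\<in>E. of_bool ((s e \<in> A) \<noteq> (t e \<in> A)))"

text \<open>The pair \<open>s e\<close>, \<open>t e\<close> is a reference direction:
  \<open>\<epsilon> e = 1\<close> directs \<open>e\<close> from \<open>s e\<close> to
  \<open>t e\<close>, and \<open>-1\<close> the other way. Loops arise by contraction and contribute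
  to neither \<open>net\<close> nor \<open>cut_size\<close>.\<close>

definition net :: "'e set \<Rightarrow> ('e \<Rightarrow> 'v) \<Rightarrow> ('e \<Rightarrow> 'v) \<Rightarrow> ('e \<Rightarrow> int) \<Rightarrow> 'v set \<Rightarrow> int" where
  "net E s t \<epsilon> A = (\<Sum>e\<in>E. \<epsilon> e * (of_bool (s e \<in> A) - of_bool (t e \<in> A)))"

definition solves :: "int \<Rightarrow> 'v set \<Rightarrow> 'e set \<Rightarrow> ('e \<Rightarrow> 'v) \<Rightarrow> ('e \<Rightarrow> 'v) \<Rightarrow> ('v \<Rightarrow> int) \<Rightarrow> ('e \<Rightarrow> int) \<Rightarrow> bool" where
  "solves M W E s t \<gamma> \<epsilon> \<longleftrightarrow> (\<forall>e\<in>E. \<epsilon> e = 1 \<or> \<epsilon> e = -1) \<and>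
     (\<forall>x\<in>W. M dvd net E s t \<epsilon> {x} - \<gamma> x)"

text \<open>\<open>a x\<close> and \<open>b x\<close> count the preoriented edges from the extra vertex \<open>z\<close> to \<open>x\<close> and from \<open>x\<close> to \<open>z\<close>;
  \<open>z\<close> itself is not represented. Thus \<open>load\<close> is the degree of a set and \<open>demand\<close> its prescribed net
  outflow in the graph with \<open>z\<close>, while \<open>\<gamma>\<close> is the prescription for the unoriented edges only.\<close>

definition load :: "'e set \<Rightarrow> ('e \<Rightarrow> 'v) \<Rightarrow> ('e \<Rightarrow> 'v) \<Rightarrow> ('v \<Rightarrow> int) \<Rightarrow> ('v \<Rightarrow> int) \<Rightarrow> 'v set \<Rightarrow> int" where
  "load E s t a b A = cut_size E s t A + (\<Sum>x\<in>A. a x + b x)"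

definition demand :: "('v \<Rightarrow> int) \<Rightarrow> ('v \<Rightarrow> int) \<Rightarrow> ('v \<Rightarrow> int) \<Rightarrow> 'v set \<Rightarrow> int" where
  "demand \<gamma> a b A = (\<Sum>x\<in>A. \<gamma> x + b x - a x)"

text \<open>The modulus is \<open>4k+2\<close> rather than \<open>2k+1\<close>: the parity of the net outflow of a set is that of its degree.
  The bound on \<open>load W\<close> is the degree condition at \<open>z\<close>. The set \<open>Z\<close> holds at most one vertex, of demand
  \<open>0\<close>, which is exempt from the degree condition so that its edges can be lifted one pair at a time.\<close>

definition admissible :: "int \<Rightarrow> 'v set \<Rightarrow> 'e set \<Rightarrow> ('e \<Rightarrow> 'v) \<Rightarrow> ('e \<Rightarrow> 'v) \<Rightarrow>
    ('v \<Rightarrow> int) \<Rightarrow> ('v \<Rightarrow> int) \<Rightarrow> ('v \<Rightarrow> int) \<Rightarrow> 'v set \<Rightarrow> bool" where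
  "admissible k W E s t \<gamma> a b Z \<longleftrightarrow>
     finite W \<and> finite E \<and> (\<forall>e\<in>E. s e \<in> W \<and> t e \<in> W) \<and>
     (\<forall>x\<in>W. 0 \<le> a x \<and> 0 \<le> b x) \<and>
     4*k+2 dvd sum \<gamma> W \<and>
     (\<forall>A. A \<subseteq> W \<longrightarrow> even (load E s t a b A + demand \<gamma> a b A)) \<and>
     load E s t a b W \<le> 4*k + cdist (4*k+2) (demand \<gamma> a b W) \<and>
     (\<forall>A. A \<subseteq> W \<longrightarrow> A \<noteq> {} \<longrightarrow> A \<noteq> W \<longrightarrow> A \<noteq> Z \<longrightarrow>
        4*k + cdist (4*k+2) (demand \<gamma> a b A) \<le> load E s t a b A) \<and>
     (Z = {} \<or> (\<exists>x\<in>W. Z = {x} \<and> 4*k+2 dvd demand \<gamma> a b {x}))"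

lemma admissibleD:
  assumes "admissible k W E s t \<gamma> a b Z"
  shows "finite W" "finite E" "\<And>e. e \<in> E \<Longrightarrow> s e \<in> W" "\<And>e. e \<in> E \<Longrightarrow> t e \<in> W"
    "\<And>x. x \<in> W \<Longrightarrow> 0 \<le> a x" "\<And>x. x \<in> W \<Longrightarrow> 0 \<le> b x"
    "4*k+2 dvd sum \<gamma> W"
    "\<And>A. A \<subseteq> W \<Longrightarrow> even (load E s t a b A + demand \<gamma> a b A)"
    "load E s t a b W \<le> 4*k + cdist (4*k+2) (demand \<gamma> a b W)"
    "\<And>A. A \<subseteq> W \<Longrightarrow> A \<noteq> {} \<Longrightarrow> A \<noteq> W \<Longrightarrow> A \<noteq> Z \<Longrightarrow>
        4*k + cdist (4*k+2) (demand \<gamma> a b A) \<le> load E s t a b A"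
    "Z = {} \<or> (\<exists>x\<in>W. Z = {x} \<and> 4*k+2 dvd demand \<gamma> a b {x})"
  using assms unfolding admissible_def by blast+

section \<open>Additivity over the vertices of a set\<close>

lemma net_insert:
  assumes "x \<notin> A"
  shows "net E s t \<epsilon> (insert x A) = net E s t \<epsilon> {x} + net E s t \<epsilon> A"
  unfolding net_def sum.distrib[symmetric] using assms by (intro sum.cong) auto

lemma sum_of_bool_eq: "finite A \<Longrightarrow> (\<Sum>x\<in>A. of_bool (v = x)) = (of_bool (v \<in> A) :: int)"
  by (simp add: of_bool_def)

lemma net_eq_sum:
  assumes "finite A"
  shows "net E s t \<epsilon> A = (\<Sum>x\<in>A. net E s t \<epsilon> {x})"
proof -
  have "(\<Sum>x\<in>A. net E s t \<epsilon> {x}) = (\<Sum>e\<in>E. \<Sum>x\<in>A. \<epsilon> e * (of_bool (s e = x) - of_bool (t e = x)))"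
    unfolding net_def by (subst sum.swap) simp
  also have "\<dots> = net E s t \<epsilon> A"
    unfolding net_def sum_distrib_left[symmetric] sum_subtractf sum_of_bool_eq[OF assms] ..
  finally show ?thesis ..
qed

lemma demand_single [simp]: "demand \<gamma> a b {x} = \<gamma> x + b x - a x"
  unfolding demand_def by simp

lemma sum_replace:
  fixes f :: "'v \<Rightarrow> int"
  assumes "finite W" "A \<subseteq> W" "r \<in> A" "B \<subseteq> insert r (W - A)"
  shows "(\<Sum>v\<in>B. if v = r then sum f A else f v) = sum f (if r \<in> B then B \<union> A else B)"
proof -
  have fin: "finite B" "finite A" using assms finite_subset by blast+
  show ?thesis
  proof (cases "r \<in> B")
    case True
    have "(\<Sum>v\<in>B. if v = r then sum f A else f v) = sum f A + (\<Sum>v\<in>B - {r}. if v = r then sum f A else f v)"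
      using True fin by (simp add: sum.remove)
    also have "(\<Sum>v\<in>B - {r}. if v = r then sum f A else f v) = sum f (B - {r})"
      by (rule sum.cong) auto
    also have "sum f A + sum f (B - {r}) = sum f (A \<union> (B - {r}))"
      using assms fin by (intro sum.union_disjoint[symmetric]) auto
    also have "A \<union> (B - {r}) = B \<union> A" using assms by auto
    finally show ?thesis using True by simp
  next
    case False
    then show ?thesis by (auto intro: sum.cong)
  qed
qed

section \<open>Reductions\<close>

text \<open>A set \<open>B\<close> of the contracted graph has the same load and demand as its
  preimage \<open>X B\<close>, so every condition is inherited from the original graph. The vertex
  \<open>r\<close> carries the total weights of \<open>A\<close>.\<close>

lemma contract_admissible:
  fixes s t :: "'e \<Rightarrow> 'v"
  assumes adm: "admissible k W E s t \<gamma> a b Z"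
    and A: "A \<subseteq> W" "r \<in> A" "q \<in> A" "q \<noteq> r"
  defines "p \<equiv> \<lambda>v. if v \<in> A then r else v"
  defines "c \<equiv> \<lambda>(f :: 'v \<Rightarrow> int) v. if v = r then sum f A else f v"
  shows "admissible k (insert r (W - A)) E (p \<circ> s) (p \<circ> t) (c \<gamma>) (c a) (c b) (Z - A)"
proof -
  note D = admissibleD[OF adm]
  let ?W = "insert r (W - A)"
  define X where "X = (\<lambda>B. if r \<in> B then B \<union> A else B)"
  have csum: "sum (c f) B = sum f (X B)" if "B \<subseteq> ?W" for B f
    using sum_replace[OF D(1) A(1,2) that, of f] unfolding c_def X_def .
  have pmem: "p v \<in> B \<longleftrightarrow> v \<in> X B" if "B \<subseteq> ?W" "v \<in> W" for v B
    using that A unfolding p_def X_def by auto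
  have cut: "cut_size E (p \<circ> s) (p \<circ> t) B = cut_size E s t (X B)" if "B \<subseteq> ?W" for B
    unfolding cut_size_def using D(3,4) by (intro sum.cong) (simp_all add: pmem[OF that])
  have load: "load E (p \<circ> s) (p \<circ> t) (c a) (c b) B = load E s t a b (X B)" if "B \<subseteq> ?W" for B
    unfolding load_def sum.distrib by (simp add: cut csum that)
  have dem: "demand (c \<gamma>) (c a) (c b) B = demand \<gamma> a b (X B)" if "B \<subseteq> ?W" for B
    unfolding demand_def sum.distrib sum_subtractf by (simp add: csum that)
  have XW: "X ?W = W" using A unfolding X_def by auto
  have Xsub: "X B \<subseteq> W" if "B \<subseteq> ?W" for B using that A unfolding X_def by auto
  have XnW: "X B \<noteq> W" if "B \<subseteq> ?W" "B \<noteq> ?W" for B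
    using that A unfolding X_def by (auto split: if_splits)
  \<comment> \<open>The second vertex \<open>q\<close> matters here: a preimage that contains
    \<open>A\<close> has two elements, so it is never the exempt singleton \<open>Z\<close>, even
    when \<open>Z\<close> lies inside \<open>A\<close>.\<close>
  have XnZ: "X B \<noteq> Z" if B: "B \<subseteq> ?W" "B \<noteq> {}" "B \<noteq> Z - A" for B
  proof (cases "r \<in> B")
    case True
    then have "q \<in> X B" "r \<in> X B" using A unfolding X_def by auto
    then show ?thesis using D(11) A(4) by auto
  next
    case False
    then show ?thesis using B A D(11) unfolding X_def by auto
  qed
  have "c f x \<ge> 0" if "x \<in> ?W" "\<And>v. v \<in> W \<Longrightarrow> 0 \<le> f v" for f x
    using that A unfolding c_def by (auto intro: sum_nonneg)
  moreover have "Z - A = {} \<or> (\<exists>x\<in>?W. Z - A = {x} \<and> 4*k+2 dvd demand (c \<gamma>) (c a) (c b) {x})"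
    using D(11) A unfolding c_def by auto
  moreover have "4*k+2 dvd sum (c \<gamma>) ?W" using csum[of ?W \<gamma>] XW D(7) by simp
  moreover have "X B \<noteq> {}" if "B \<noteq> {}" for B using that unfolding X_def by auto
  moreover have "p (s e) \<in> ?W \<and> p (t e) \<in> ?W" if "e \<in> E" for e
    using D(3,4)[OF that] unfolding p_def by auto
  ultimately show ?thesis
    unfolding admissible_def using D(1,2,5,6,8-10)
    by (simp add: load dem XW Xsub XnW XnZ)
qed

lemma contract_net:
  assumes "\<And>e. e \<in> E \<Longrightarrow> s e \<in> W \<and> t e \<in> W" "r \<in> A" "x \<in> insert r (W - A)"
  shows "net E ((\<lambda>v. if v \<in> A then r else v) \<circ> s) ((\<lambda>v. if v \<in> A then r else v) \<circ> t) \<epsilon> {x}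
     = net E s t \<epsilon> (if x = r then A else {x})"
  unfolding net_def using assms by (intro sum.cong) auto

text \<open>If the contraction of \<open>A\<close> is solved, the edges leaving \<open>A\<close> become oriented, and for the
  subgraph inside \<open>A\<close> they play the role of the edges counted by \<open>a\<close> (incoming) and \<open>b\<close> (outgoing).\<close>

lemma restrict_admissible:
  assumes adm: "admissible k W E s t \<gamma> a b Z"
    and A: "A \<subseteq> W"
    and tight: "load E s t a b A \<le> 4*k + cdist (4*k+2) (demand \<gamma> a b A)"
    and eps: "\<forall>e\<in>E. \<epsilon> e = 1 \<or> \<epsilon> e = -1"
    and netA: "4*k+2 dvd net E s t \<epsilon> A - sum \<gamma> A"
  defines "E2 \<equiv> {e\<in>E. s e \<in> A \<and> t e \<in> A}"
  shows "\<exists>a2 b2. admissible k A E2 s t (\<lambda>x. \<gamma> x - net (E - E2) s t \<epsilon> {x}) a2 b2 (Z \<inter> A)"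
proof -
  note D = admissibleD[OF adm]
  let ?F = "E - E2"
  \<comment> \<open>Head and tail of \<open>e\<close> under the orientation
    \<open>\<epsilon>\<close>. An edge of \<open>?F\<close> with its head in \<open>A\<close> enters
    \<open>A\<close> and is added to \<open>a\<close>, one with its tail in \<open>A\<close> is
    added to \<open>b\<close>.\<close>
  define hd where "hd = (\<lambda>e. if \<epsilon> e = 1 then t e else s e)"
  define tl where "tl = (\<lambda>e. if \<epsilon> e = 1 then s e else t e)"
  define a2 where "a2 = (\<lambda>x. a x + (\<Sum>e\<in>?F. of_bool (hd e = x)))"
  define b2 where "b2 = (\<lambda>x. b x + (\<Sum>e\<in>?F. of_bool (tl e = x)))"
  let ?g = "\<lambda>x. \<gamma> x - net ?F s t \<epsilon> {x}"
  have finA: "finite A" using A D(1) finite_subset by blast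
  have sw: "(\<Sum>x\<in>B. \<Sum>e\<in>?F. of_bool (f e = x)) = (\<Sum>e\<in>?F. of_bool (f e \<in> B) :: int)" if "B \<subseteq> A" for B f
    by (subst sum.swap) (simp only: sum_of_bool_eq finite_subset[OF that finA])
  have load: "load E2 s t a2 b2 B = load E s t a b B" if B: "B \<subseteq> A" for B
  proof -
    have "(\<Sum>x\<in>B. a2 x + b2 x) = (\<Sum>x\<in>B. a x + b x) + (\<Sum>e\<in>?F. of_bool (hd e \<in> B) + of_bool (tl e \<in> B))"
      unfolding a2_def b2_def by (simp add: sum.distrib sw[OF B])
    also have "(\<Sum>e\<in>?F. of_bool (hd e \<in> B) + of_bool (tl e \<in> B)) = cut_size ?F s t B"
      unfolding cut_size_def hd_def tl_def E2_def using B by (intro sum.cong) auto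
    also have "cut_size E s t B = cut_size E2 s t B + cut_size ?F s t B"
      unfolding cut_size_def using D(2) by (subst sum.subset_diff[of E2 E]) (auto simp: E2_def)
    ultimately show ?thesis unfolding load_def by simp
  qed
  have netF: "net ?F s t \<epsilon> B = (\<Sum>e\<in>?F. of_bool (tl e \<in> B) - of_bool (hd e \<in> B))" for B
    unfolding net_def hd_def tl_def using eps by (intro sum.cong) auto
  have dem: "demand ?g a2 b2 B = demand \<gamma> a b B" if B: "B \<subseteq> A" for B
  proof -
    have finB: "finite B" using finite_subset[OF B finA] .
    have "demand ?g a2 b2 B = demand \<gamma> a b B + (\<Sum>e\<in>?F. of_bool (tl e \<in> B) - of_bool (hd e \<in> B)) - (\<Sum>x\<in>B. net ?F s t \<epsilon> {x})"
      unfolding a2_def b2_def demand_def by (simp add: sum.distrib sum_subtractf sw[OF B])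
    then show ?thesis unfolding net_eq_sum[OF finB, symmetric] by (simp add: netF)
  qed
  have netEA: "net E s t \<epsilon> A = net ?F s t \<epsilon> A"
  proof -
    have "net E s t \<epsilon> A = net ?F s t \<epsilon> A + net E2 s t \<epsilon> A"
      unfolding net_def using D(2) by (subst sum.subset_diff[of E2 E]) (auto simp: E2_def)
    moreover have "net E2 s t \<epsilon> A = 0" unfolding net_def E2_def by simp
    ultimately show ?thesis by simp
  qed
  have "sum ?g A = sum \<gamma> A - net E s t \<epsilon> A"
    by (simp add: sum_subtractf net_eq_sum[OF finA, symmetric] netEA)
  then have g0: "4*k+2 dvd sum ?g A" using netA by (simp add: dvd_diff_commute)
  have nn: "0 \<le> a2 x \<and> 0 \<le> b2 x" if "x \<in> A" for x
    using D(5,6) that A unfolding a2_def b2_def by (auto intro!: add_nonneg_nonneg sum_nonneg)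
  have "Z \<inter> A = {} \<or> (\<exists>x\<in>A. Z \<inter> A = {x} \<and> 4*k+2 dvd demand ?g a2 b2 {x})"
  proof (cases "Z \<inter> A = {}")
    case False
    then obtain x where x: "x \<in> A" "Z = {x}" "4*k+2 dvd demand \<gamma> a b {x}" using D(11) by auto
    then have "4*k+2 dvd demand ?g a2 b2 {x}" using dem[of "{x}"] x by (simp del: demand_single)
    then show ?thesis using x by auto
  qed simp
  moreover have "even (load E2 s t a2 b2 B + demand ?g a2 b2 B)" if "B \<subseteq> A" for B
    unfolding load[OF that] dem[OF that] using D(8)[of B] that A by blast
  \<comment> \<open>Tightness of \<open>A\<close> enters here: the outside of \<open>A\<close> is
    now merged into the extra vertex, whose degree is the load of \<open>A\<close>.\<close>
  moreover have "load E2 s t a2 b2 A \<le> 4*k + cdist (4*k+2) (demand ?g a2 b2 A)"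
    using tight by (simp only: load dem subset_refl)
  moreover have "4*k + cdist (4*k+2) (demand ?g a2 b2 B) \<le> load E2 s t a2 b2 B"
    if "B \<subseteq> A" "B \<noteq> {}" "B \<noteq> A" "B \<noteq> Z \<inter> A" for B
  proof -
    have "B \<noteq> Z" using that by auto
    moreover have "B \<noteq> W" using that A by auto
    ultimately show ?thesis
      unfolding load[OF that(1)] dem[OF that(1)] using D(10)[of B] that A by blast
  qed
  ultimately have "admissible k A E2 s t ?g a2 b2 (Z \<inter> A)"
    unfolding admissible_def using finA D(2) g0 nn by (auto simp: E2_def)
  then show ?thesis by blast
qed


section \<open>Counting edges across a cut\<close>

lemma load_single: "load E s t a b {x} = cut_size E s t {x} + a x + b x"
  unfolding load_def by simp

text \<open>Edges between \<open>A\<close> and \<open>W - A\<close> are counted on both sides,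
  preoriented edges on exactly one side; the latter alone make up \<open>load W\<close>, since no
  edge of \<open>E\<close> leaves \<open>W\<close>.\<close>

lemma admissible_split:
  assumes adm: "admissible k W E s t \<gamma> a b Z" and A: "A \<subseteq> W"
  shows "cut_size E s t W = 0"
    "load E s t a b A + load E s t a b (W - A) = load E s t a b W + 2 * cut_size E s t A"
    "demand \<gamma> a b W = demand \<gamma> a b A + demand \<gamma> a b (W - A)"
proof -
  note D = admissibleD[OF adm]
  have sp: "sum f W = sum f A + sum f (W - A)" for f :: "_ \<Rightarrow> int"
    using sum.subset_diff[OF A D(1), of f] by simp
  show *: "cut_size E s t W = 0" unfolding cut_size_def using D(3,4) by simp
  have "cut_size E s t (W - A) = cut_size E s t A"
    unfolding cut_size_def using D(3,4) by (intro sum.cong) auto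
  then show "load E s t a b A + load E s t a b (W - A) = load E s t a b W + 2 * cut_size E s t A"
    unfolding load_def sp[of "\<lambda>x. a x + b x"] using * by simp
  show "demand \<gamma> a b W = demand \<gamma> a b A + demand \<gamma> a b (W - A)"
    unfolding demand_def by (rule sp)
qed

text \<open>The degree bound at the extra vertex is combined with subadditivity of
  \<open>cdist\<close>. If both \<open>A\<close> and \<open>W - A\<close> satisfy the degree
  condition, at least \<open>2k\<close> edges cross between them.\<close>

lemma admissible_cut_bound:
  assumes adm: "admissible k W E s t \<gamma> a b Z" and k: "k \<ge> 1" and A: "A \<subseteq> W"
  shows "load E s t a b A + load E s t a b (W - A)
    \<le> 4*k + cdist (4*k+2) (demand \<gamma> a b A) + cdist (4*k+2) (demand \<gamma> a b (W - A)) + 2 * cut_size E s t A"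
  using admissible_split[OF adm A] admissibleD(9)[OF adm] k
    cdist_add[of "4*k+2" "demand \<gamma> a b A" "demand \<gamma> a b (W - A)"] by simp

lemma cut_size_diff:
  assumes "finite E" "F \<subseteq> E"
  shows "cut_size E s t A = cut_size (E - F) s t A + cut_size F s t A"
  unfolding cut_size_def using sum.subset_diff[OF assms(2,1)] by simp

lemma net_diff:
  assumes "finite E" "F \<subseteq> E"
  shows "net E s t \<epsilon> A = net (E - F) s t \<epsilon> A + net F s t \<epsilon> A"
  unfolding net_def using sum.subset_diff[OF assms(2,1)] by simp

lemma cut_size_cong:
  "(\<And>e. e \<in> E \<Longrightarrow> s e = s' e \<and> t e = t' e) \<Longrightarrow> cut_size E s t A = cut_size E s' t' A"
  unfolding cut_size_def by (intro sum.cong) auto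

lemma net_cong:
  "(\<And>e. e \<in> E \<Longrightarrow> s e = s' e \<and> t e = t' e \<and> \<epsilon> e = \<epsilon>' e) \<Longrightarrow> net E s t \<epsilon> A = net E s' t' \<epsilon>' A"
  unfolding net_def by (intro sum.cong) auto

section \<open>Lifting, deleting and reversing edges\<close>

text \<open>The edges \<open>xu\<close> and \<open>xw\<close> are replaced by one edge
  \<open>uw\<close>, which reuses the name \<open>e1\<close>. Only a set separating \<open>x\<close>
  from both \<open>u\<close> and \<open>w\<close> loses load, namely \<open>2\<close>. Such a set is
  \<open>{x}\<close> or has several elements on account of \<open>u \<noteq> w\<close>, and in the
  latter case the slack covers the loss.\<close>

lemma lift_admissible:
  assumes adm: "admissible k W E s t \<gamma> a b Z" and Z: "Z \<subseteq> {x}" and x: "x \<in> W"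
    and e: "e1 \<in> E" "e2 \<in> E" "e1 \<noteq> e2" "{s e1, t e1} = {x, u}" "{s e2, t e2} = {x, w}"
      "u \<noteq> x" "w \<noteq> x" "u \<noteq> w"
    and slack: "\<And>A. A \<subseteq> W \<Longrightarrow> A \<noteq> {} \<Longrightarrow> A \<noteq> W \<Longrightarrow> (\<And>v. A \<noteq> {v}) \<Longrightarrow>
        4*k + 2 + cdist (4*k+2) (demand \<gamma> a b A) \<le> load E s t a b A"
    and xs: "4*k+2 dvd demand \<gamma> a b {x} \<or>
        4*k + 2 + cdist (4*k+2) (demand \<gamma> a b {x}) \<le> load E s t a b {x}"
  shows "\<exists>Z'. admissible k W (E - {e2}) (s(e1 := u)) (t(e1 := w)) \<gamma> a b Z'"
proof -
  note D = admissibleD[OF adm]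
  let ?s = "s(e1 := u)" and ?t = "t(e1 := w)" and ?E = "E - {e2}"
  \<comment> \<open>If \<open>x\<close> has demand \<open>0\<close>, its degree may drop below the
    bound, so \<open>{x}\<close> becomes or stays exempt. Otherwise \<open>xs\<close> provides slack
    \<open>2\<close> at \<open>x\<close> as well.\<close>
  let ?Z = "if 4*k+2 dvd demand \<gamma> a b {x} then {x} else {}"
  have cutE: "cut_size E s t A = cut_size (E - {e1,e2}) s t A + of_bool ((x \<in> A) \<noteq> (u \<in> A)) + of_bool ((x \<in> A) \<noteq> (w \<in> A))" for A
  proof -
    have "cut_size {e1,e2} s t A = of_bool ((x \<in> A) \<noteq> (u \<in> A)) + of_bool ((x \<in> A) \<noteq> (w \<in> A))"
      unfolding cut_size_def using e by (auto simp: doubleton_eq_iff)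
    then show ?thesis using cut_size_diff[OF D(2), of "{e1,e2}" s t A] e by simp
  qed
  have cutE': "cut_size ?E ?s ?t A = cut_size (E - {e1,e2}) s t A + of_bool ((u \<in> A) \<noteq> (w \<in> A))" for A
  proof -
    have "?E - {e1} = E - {e1,e2}" by auto
    moreover have "cut_size {e1} ?s ?t A = of_bool ((u \<in> A) \<noteq> (w \<in> A))" unfolding cut_size_def by simp
    moreover have "cut_size (E - {e1,e2}) ?s ?t A = cut_size (E - {e1,e2}) s t A"
      by (rule cut_size_cong) auto
    ultimately show ?thesis using cut_size_diff[of ?E "{e1}" ?s ?t A] D(2) e by simp
  qed
  have uw: "u \<in> W" "w \<in> W" using e D(3,4) by (metis doubleton_eq_iff)+
  have load: "load ?E ?s ?t a b A = load E s t a b A - 2 * of_bool ((x \<in> A) \<noteq> (u \<in> A) \<and> (x \<in> A) \<noteq> (w \<in> A))" for A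
    unfolding load_def cutE cutE' by (auto split: if_splits)
  have "4*k + cdist (4*k+2) (demand \<gamma> a b A) \<le> load ?E ?s ?t a b A"
    if A: "A \<subseteq> W" "A \<noteq> {}" "A \<noteq> W" "A \<noteq> ?Z" for A
  proof (cases "\<exists>v. A = {v}")
    case True
    then obtain v where v: "A = {v}" by blast
    show ?thesis
    proof (cases "v = x")
      case True
      then have "\<not> 4*k+2 dvd demand \<gamma> a b {x}" using A v by auto
      then show ?thesis using xs v True unfolding load by simp
    next
      case False
      then have "A \<noteq> Z" using v Z by auto
      then show ?thesis using D(10)[of A] A v False e unfolding load by auto
    qed
  next
    case False
    then show ?thesis using slack[of A] A unfolding load by (auto simp: of_bool_def)
  qed
  moreover have "?Z = {} \<or> (\<exists>y\<in>W. ?Z = {y} \<and> 4*k+2 dvd demand \<gamma> a b {y})"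
    using x by auto
  ultimately have "admissible k W ?E ?s ?t \<gamma> a b ?Z"
    unfolding admissible_def using D(1,2,3,4,5,6,7,8,9) uw load[of W] x
    by (auto simp: load)
  then show ?thesis by blast
qed

lemma lift_solves:
  assumes fin: "finite E"
    and e: "e1 \<in> E" "e2 \<in> E" "e1 \<noteq> e2" "{s e1, t e1} = {x, u}" "{s e2, t e2} = {x, w}"
      "u \<noteq> x" "w \<noteq> x" "u \<noteq> w"
    and sol: "solves M W (E - {e2}) (s(e1 := u)) (t(e1 := w)) \<gamma> \<epsilon>"
  shows "\<exists>\<epsilon>'. solves M W E s t \<gamma> \<epsilon>'"
proof -
  let ?s = "s(e1 := u)" and ?t = "t(e1 := w)" and ?E = "E - {e2}"
  \<comment> \<open>The new edge is subdivided at \<open>x\<close>: when it runs from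
    \<open>u\<close> to \<open>w\<close>, then \<open>e1\<close> runs from \<open>u\<close> to
    \<open>x\<close> and \<open>e2\<close> from \<open>x\<close> to \<open>w\<close>, so
    \<open>x\<close> gains nothing. The case distinctions translate this into the reference
    directions.\<close>
  let ?d = "\<epsilon>(e1 := if s e1 = u then \<epsilon> e1 else - \<epsilon> e1, e2 := if s e2 = x then \<epsilon> e1 else - \<epsilon> e1)"
  have "net E s t ?d A = net ?E ?s ?t \<epsilon> A" for A
  proof -
    have 1: "?E - {e1} = E - {e1,e2}" by auto
    have 2: "net {e1} ?s ?t \<epsilon> A = net {e1, e2} s t ?d A"
      unfolding net_def using e by (auto simp: doubleton_eq_iff)
    have 3: "net (E - {e1,e2}) ?s ?t \<epsilon> A = net (E - {e1,e2}) s t ?d A"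
      by (rule net_cong) auto
    show ?thesis
      using net_diff[of E "{e1,e2}" s t ?d A] net_diff[of ?E "{e1}" ?s ?t \<epsilon> A] fin e 1 2 3 by simp
  qed
  moreover have "\<forall>e\<in>E. ?d e = 1 \<or> ?d e = -1"
    using sol e unfolding solves_def by auto
  ultimately have "solves M W E s t \<gamma> ?d" using sol unfolding solves_def by simp
  then show ?thesis by blast
qed

text \<open>Deletes the edge \<open>e\<close> after directing it from \<open>y\<close> to \<open>x\<close>, and adds \<open>c\<close> preoriented edges out of \<open>x\<close>.\<close>

lemma delete_admissible:
  assumes adm: "admissible k W E s t \<gamma> a b {}" and k: "k \<ge> 1"
    and e: "e \<in> E" "{s e, t e} = {x, y}" "x \<noteq> y" and c: "c \<ge> 0"
    and slack: "\<And>A. A \<subseteq> W \<Longrightarrow> A \<noteq> {} \<Longrightarrow> A \<noteq> W \<Longrightarrow> (\<And>v. A \<noteq> {v}) \<Longrightarrow>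
        4*k + 2 + cdist (4*k+2) (demand \<gamma> a b A) \<le> load E s t a b A"
    and x: "cdist (4*k+2) (demand \<gamma> a b {x} + c + 1) < cdist (4*k+2) (demand \<gamma> a b {x}) + c"
    and y: "cdist (4*k+2) (demand \<gamma> a b {y} - 1) < cdist (4*k+2) (demand \<gamma> a b {y})"
    and tot: "load E s t a b W + c \<le> 4*k + cdist (4*k+2) (demand \<gamma> a b W + c)"
  shows "admissible k W (E - {e}) s t (\<gamma>(x := \<gamma> x + 1, y := \<gamma> y - 1)) a (b(x := b x + c)) {}"
proof -
  note D = admissibleD[OF adm]
  let ?g = "\<gamma>(x := \<gamma> x + 1, y := \<gamma> y - 1)" and ?b = "b(x := b x + c)" and ?E = "E - {e}"
  let ?M = "4*k+2"
  have xy: "x \<in> W" "y \<in> W" using e D(3,4) by (metis doubleton_eq_iff)+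
  have upd: "sum (f(v := f v + d)) A = sum f A + d * of_bool (v \<in> A)" if "A \<subseteq> W"
    for f :: "'a \<Rightarrow> int" and v d A
    using finite_subset[OF that D(1)]
    by (cases "v \<in> A") (auto simp: sum.remove[of A v] intro!: sum.cong)
  have upd2: "sum (f(x := f x + 1, y := f y - 1)) A = sum f A + of_bool (x \<in> A) - of_bool (y \<in> A)" if "A \<subseteq> W"
    for f :: "'a \<Rightarrow> int" and A
    using upd[OF that, of "f(x := f x + 1)" y "-1"] upd[OF that, of f x 1] e by simp
  have cut: "cut_size ?E s t A = cut_size E s t A - of_bool ((x \<in> A) \<noteq> (y \<in> A))" for A
  proof -
    have "cut_size {e} s t A = of_bool ((x \<in> A) \<noteq> (y \<in> A))"
      unfolding cut_size_def using e by (auto simp: doubleton_eq_iff)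
    then show ?thesis using cut_size_diff[OF D(2), of "{e}" s t A] e by simp
  qed
  have load: "load ?E s t a ?b A = load E s t a b A - of_bool ((x \<in> A) \<noteq> (y \<in> A)) + c * of_bool (x \<in> A)"
    if "A \<subseteq> W" for A
    unfolding load_def sum.distrib cut upd[OF that] by simp
  have dem: "demand ?g a ?b A = demand \<gamma> a b A + (c + 1) * of_bool (x \<in> A) - of_bool (y \<in> A)"
    if "A \<subseteq> W" for A
    unfolding demand_def sum.distrib sum_subtractf upd[OF that] upd2[OF that] by (simp add: algebra_simps)
  have "4*k + cdist ?M (demand ?g a ?b A) \<le> load ?E s t a ?b A"
    if A: "A \<subseteq> W" "A \<noteq> {}" "A \<noteq> W" for A
  proof (cases "\<exists>v. A = {v}")
    case True
    then obtain v where v: "A = {v}" by blast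
    have "4*k + cdist ?M (demand \<gamma> a b A) \<le> load E s t a b A" using D(10) A by simp
    then show ?thesis using x y v e A unfolding load[OF A(1)] dem[OF A(1)]
      by (cases "v = x"; cases "v = y") (auto simp: algebra_simps)
  next
    case False
    \<comment> \<open>If \<open>A\<close> contains \<open>x\<close> but not \<open>y\<close>, the
      load changes by \<open>c - 1\<close> and the demand by \<open>c + 1\<close>; the slack
      \<open>2\<close> is exactly the difference. The other positions of \<open>x\<close> and
      \<open>y\<close> cost at most as much.\<close>
    have "4*k + 2 + cdist ?M (demand \<gamma> a b A) \<le> load E s t a b A" using slack A False by blast
    moreover have "cdist ?M (demand \<gamma> a b A + d) \<le> cdist ?M (demand \<gamma> a b A) + \<bar>d\<bar>" for d
      using cdist_add_le[of ?M] k by simp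
    from this[of "(c + 1) * of_bool (x \<in> A) - of_bool (y \<in> A)"]
    have "cdist ?M (demand ?g a ?b A) \<le> cdist ?M (demand \<gamma> a b A) + \<bar>(c + 1) * of_bool (x \<in> A) - of_bool (y \<in> A)\<bar>"
      unfolding dem[OF A(1)] by (simp add: algebra_simps)
    ultimately show ?thesis using c unfolding load[OF A(1)]
      by (cases "x \<in> A"; cases "y \<in> A") auto
  qed
  moreover have "even (load ?E s t a ?b A + demand ?g a ?b A)" if "A \<subseteq> W" for A
    using D(8)[OF that] unfolding load[OF that] dem[OF that]
    by (cases "x \<in> A"; cases "y \<in> A") auto
  moreover have "load ?E s t a ?b W \<le> 4*k + cdist ?M (demand ?g a ?b W)"
    unfolding load[OF subset_refl] dem[OF subset_refl] using tot xy by simp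
  moreover have "?M dvd sum ?g W" using D(7) upd2[of W \<gamma>] xy by simp
  ultimately show ?thesis
    unfolding admissible_def using D(1-6) c by auto
qed

lemma delete_solves:
  assumes fin: "finite E" and e: "e \<in> E" "{s e, t e} = {x, y}" "x \<noteq> y"
    and sol: "solves M W (E - {e}) s t (\<gamma>(x := \<gamma> x + 1, y := \<gamma> y - 1)) \<epsilon>"
  shows "\<exists>\<epsilon>'. solves M W E s t \<gamma> \<epsilon>'"
proof -
  let ?d = "\<epsilon>(e := if s e = y then 1 else -1)"
  have "net E s t ?d {v} = net (E - {e}) s t \<epsilon> {v} + of_bool (v = y) - of_bool (v = x)" for v
  proof -
    have "net {e} s t ?d {v} = of_bool (v = y) - of_bool (v = x)"
      unfolding net_def using e by (auto simp: doubleton_eq_iff)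
    moreover have "net (E - {e}) s t ?d {v} = net (E - {e}) s t \<epsilon> {v}" by (rule net_cong) auto
    ultimately show ?thesis using net_diff[OF fin, of "{e}" s t ?d "{v}"] e by simp
  qed
  then have "net E s t ?d {v} - \<gamma> v = net (E - {e}) s t \<epsilon> {v} - (\<gamma>(x := \<gamma> x + 1, y := \<gamma> y - 1)) v" for v
    using e by simp
  then have "solves M W E s t \<gamma> ?d" using sol e unfolding solves_def by (simp only:) simp
  then show ?thesis by blast
qed

text \<open>Removes one preoriented edge from \<open>x\<close> to the extra vertex. The prescription
  \<open>\<gamma>\<close> for the unoriented edges stays the same, so a solution carries over
  unchanged.\<close>

lemma decrease_admissible:
  assumes adm: "admissible k W E s t \<gamma> a b {}" and k: "k \<ge> 1"
    and x: "x \<in> W" "b x > 0"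
    and slack: "\<And>A. A \<subseteq> W \<Longrightarrow> A \<noteq> {} \<Longrightarrow> A \<noteq> W \<Longrightarrow> (\<And>v. A \<noteq> {v}) \<Longrightarrow>
        4*k + 2 + cdist (4*k+2) (demand \<gamma> a b A) \<le> load E s t a b A"
    and dx: "cdist (4*k+2) (demand \<gamma> a b {x} - 1) < cdist (4*k+2) (demand \<gamma> a b {x})"
  shows "admissible k W E s t \<gamma> a (b(x := b x - 1)) {}"
proof -
  note D = admissibleD[OF adm]
  let ?b = "b(x := b x - 1)" and ?M = "4*k+2"
  have upd: "sum ?b A = sum b A - of_bool (x \<in> A)" if "A \<subseteq> W" for A
    using finite_subset[OF that D(1)]
    by (cases "x \<in> A") (auto simp: sum.remove[of A x] intro!: sum.cong)
  have load: "load E s t a ?b A = load E s t a b A - of_bool (x \<in> A)" if "A \<subseteq> W" for A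
    unfolding load_def sum.distrib upd[OF that] by simp
  have dem: "demand \<gamma> a ?b A = demand \<gamma> a b A - of_bool (x \<in> A)" if "A \<subseteq> W" for A
    unfolding demand_def sum.distrib sum_subtractf upd[OF that] by simp
  have lip: "cdist ?M (demand \<gamma> a b A - 1) \<le> cdist ?M (demand \<gamma> a b A) + 1"
      "cdist ?M (demand \<gamma> a b A) \<le> cdist ?M (demand \<gamma> a b A - 1) + 1" for A
    using cdist_add_le[of ?M "demand \<gamma> a b A" "-1"] cdist_add_le[of ?M "demand \<gamma> a b A - 1" 1] k by auto
  have "4*k + cdist ?M (demand \<gamma> a ?b A) \<le> load E s t a ?b A"
    if A: "A \<subseteq> W" "A \<noteq> {}" "A \<noteq> W" for A
  proof (cases "\<exists>v. A = {v}")
    case True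
    then show ?thesis using D(10)[OF A A(2)] dx unfolding load[OF A(1)] dem[OF A(1)] by auto
  next
    case False
    then have "4*k + 2 + cdist ?M (demand \<gamma> a b A) \<le> load E s t a b A" using slack A by blast
    then show ?thesis using lip[of A] unfolding load[OF A(1)] dem[OF A(1)] by auto
  qed
  moreover have "even (load E s t a ?b A + demand \<gamma> a ?b A)" if "A \<subseteq> W" for A
    using D(8)[OF that] unfolding load[OF that] dem[OF that] by auto
  moreover have "load E s t a ?b W \<le> 4*k + cdist ?M (demand \<gamma> a ?b W)"
    using D(9) lip[of W] x by (simp add: load dem)
  ultimately show ?thesis
    unfolding admissible_def using D(1-7) x by auto
qed

text \<open>Reversing every edge exchanges \<open>a\<close> and \<open>b\<close> and negates all
  prescriptions. This reduces the case of negative demands to that of positive ones.\<close>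

lemma reverse_admissible:
  assumes adm: "admissible k W E s t \<gamma> a b Z" and k: "k \<ge> 1"
  shows "admissible k W E s t (\<lambda>x. - \<gamma> x) b a Z"
proof -
  have load: "load E s t b a A = load E s t a b A" for A
    unfolding load_def by (simp add: add.commute)
  have dem: "demand (\<lambda>x. - \<gamma> x) b a A = - demand \<gamma> a b A" for A
    unfolding demand_def by (subst sum_negf[symmetric]) (simp add: algebra_simps)
  have cd: "cdist (4*k+2) (demand (\<lambda>x. - \<gamma> x) b a A) = cdist (4*k+2) (demand \<gamma> a b A)" for A
    unfolding dem using cdist_minus k by simp
  note D = admissibleD[OF adm]
  have "Z = {} \<or> (\<exists>x\<in>W. Z = {x} \<and> 4*k+2 dvd demand (\<lambda>x. - \<gamma> x) b a {x})"
    using D(11) unfolding dem dvd_minus_iff .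
  moreover have "even (load E s t b a A + demand (\<lambda>x. - \<gamma> x) b a A)" if "A \<subseteq> W" for A
    using D(8)[OF that] unfolding load dem by simp
  ultimately show ?thesis
    unfolding admissible_def cd load using D(1-7,9,10) by (simp add: sum_negf)
qed

lemma reverse_solves:
  assumes "solves M W E s t (\<lambda>x. - \<gamma> x) \<epsilon>"
  shows "solves M W E s t \<gamma> (\<lambda>e. - \<epsilon> e)"
proof -
  have "net E s t (\<lambda>e. - \<epsilon> e) A = - net E s t \<epsilon> A" for A
    unfolding net_def by (simp add: sum_negf)
  then show ?thesis using assms unfolding solves_def
    by (auto simp: dvd_diff_commute) (metis add.inverse_inverse dvd_minus_iff minus_add_distrib uminus_add_conv_diff add.commute)+
qed

section \<open>Direct solutions\<close>

lemma sign_sum: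
  assumes "finite F" "\<bar>g\<bar> \<le> int (card F)" "even (g + int (card F))"
  shows "\<exists>\<epsilon>. (\<forall>e. \<epsilon> e = 1 \<or> \<epsilon> e = -1) \<and> (\<Sum>e\<in>F. \<epsilon> e) = g"
proof -
  \<comment> \<open>\<open>n\<close> is the number of signs \<open>+1\<close>: then
    \<open>n - (card F - n)\<close> equals \<open>g\<close>.\<close>
  define n where "n = nat ((g + int (card F)) div 2)"
  have n: "2 * int n = g + int (card F)" using assms(2,3) unfolding n_def by auto
  then have "n \<le> card F" using assms(2) by linarith
  then obtain P where P: "P \<subseteq> F" "card P = n" using obtain_subset_with_card_n by metis
  let ?e = "\<lambda>e. if e \<in> P then 1 else -1 :: int"
  have "(\<Sum>e\<in>F. ?e e) = (\<Sum>e\<in>P. ?e e) + (\<Sum>e\<in>F-P. ?e e)"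
    using sum.subset_diff[OF P(1) assms(1), of ?e] by simp
  also have "(\<Sum>e\<in>P. ?e e) = int n" using P by simp
  also have "(\<Sum>e\<in>F-P. ?e e) = - int (card (F - P))" by simp
  also have "int (card (F - P)) = int (card F) - int n"
    using P \<open>n \<le> card F\<close> by (simp add: card_Diff_subset finite_subset[OF P(1) assms(1)] of_nat_diff)
  finally have "(\<Sum>e\<in>F. ?e e) = g" using n by simp
  then show ?thesis by (intro exI[of _ ?e]) auto
qed


text \<open>All non-loop edges at \<open>x\<close> lead to \<open>y\<close>, so
  \<open>\<epsilon>\<close> can be redefined on them to give \<open>x\<close> any net outflow of the
  right parity up to their number. The value at \<open>y\<close> is then right because that of
  \<open>{x, y}\<close> is.\<close>

lemma pendant_solves:
  assumes fin: "finite E" and E: "\<And>e. e \<in> E \<Longrightarrow> s e \<in> W \<and> t e \<in> W"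
    and M: "M > 0" "even M" and xy: "x \<in> W" "y \<in> W" "x \<noteq> y"
    and pend: "\<And>e u. e \<in> E \<Longrightarrow> {s e, t e} = {x, u} \<Longrightarrow> u \<noteq> x \<Longrightarrow> u = y"
    and cut: "cdist M (\<gamma> x) \<le> cut_size E s t {x}" "even (cut_size E s t {x} + \<gamma> x)"
    and netA: "M dvd net E s t \<epsilon> {x, y} - (\<gamma> x + \<gamma> y)"
    and netv: "\<And>v. v \<in> W \<Longrightarrow> v \<noteq> x \<Longrightarrow> v \<noteq> y \<Longrightarrow> M dvd net E s t \<epsilon> {v} - \<gamma> v"
    and eps: "\<forall>e\<in>E. \<epsilon> e = 1 \<or> \<epsilon> e = -1"
  shows "\<exists>\<epsilon>. solves M W E s t \<gamma> \<epsilon>"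
proof -
  let ?F = "{e\<in>E. (s e = x) \<noteq> (t e = x)}"
  obtain g where g: "M dvd \<gamma> x - g" "\<bar>g\<bar> = cdist M (\<gamma> x)" using cdist_rep[OF M(1)] .
  have cF: "int (card ?F) = cut_size E s t {x}"
    unfolding cut_size_def using fin by (simp add: of_bool_def sum.If_cases Int_def)
  have "even (\<gamma> x - g)" using g(1) M(2) dvd_trans by blast
  then have "even (g + int (card ?F))" using cut(2) cF by presburger
  then obtain \<eta> where \<eta>: "\<And>e. \<eta> e = 1 \<or> \<eta> e = (-1::int)" "(\<Sum>e\<in>?F. \<eta> e) = g"
    using sign_sum[of ?F g] fin g(2) cut(1) cF by auto
  define \<delta> where "\<delta> = (\<lambda>e. if e \<in> ?F then (if s e = x then \<eta> e else - \<eta> e) else \<epsilon> e)"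
  have Fy: "{s e, t e} = {x, y}" if "e \<in> ?F" for e
    using that pend[of e "s e"] pend[of e "t e"] by auto
  \<comment> \<open>New signs on edges between \<open>x\<close> and \<open>y\<close> are invisible
    to sets that contain both or neither.\<close>
  have same: "net E s t \<delta> B = net E s t \<epsilon> B" if "x \<in> B \<longleftrightarrow> y \<in> B" for B
    unfolding net_def
  proof (rule sum.cong[OF refl])
    fix e assume "e \<in> E"
    show "\<delta> e * (of_bool (s e \<in> B) - of_bool (t e \<in> B)) = \<epsilon> e * (of_bool (s e \<in> B) - of_bool (t e \<in> B))"
    proof (cases "e \<in> ?F")
      case True
      then have "s e \<in> B \<longleftrightarrow> t e \<in> B" using Fy[OF True] that by (auto simp: doubleton_eq_iff)
      then show ?thesis by simp
    next
      case False
      then have "\<delta> e = \<epsilon> e" unfolding \<delta>_def by (simp only: if_False)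
      then show ?thesis by simp
    qed
  qed
  have "net E s t \<delta> {x} = net ?F s t \<delta> {x}"
    unfolding net_def by (rule sum.mono_neutral_right[OF fin]) auto
  also have "\<dots> = (\<Sum>e\<in>?F. \<eta> e)"
    unfolding net_def \<delta>_def by (intro sum.cong) auto
  finally have nx: "M dvd net E s t \<delta> {x} - \<gamma> x" using \<eta>(2) g(1) by (simp add: dvd_diff_commute)
  have "net E s t \<delta> {x, y} = net E s t \<delta> {x} + net E s t \<delta> {y}"
    by (rule net_insert) (use xy in simp)
  then have "net E s t \<delta> {y} - \<gamma> y = (net E s t \<epsilon> {x, y} - (\<gamma> x + \<gamma> y)) - (net E s t \<delta> {x} - \<gamma> x)"
    using same[of "{x, y}"] by simp
  then have ny: "M dvd net E s t \<delta> {y} - \<gamma> y" using netA nx by (metis dvd_diff)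
  have "M dvd net E s t \<delta> {v} - \<gamma> v" if "v \<in> W" for v
    using nx ny netv[OF that] same[of "{v}"] by (cases "v = x"; cases "v = y") auto
  moreover have "\<forall>e\<in>E. \<delta> e = 1 \<or> \<delta> e = -1" 
  proof
    fix e assume "e \<in> E"
    then show "\<delta> e = 1 \<or> \<delta> e = -1" using eps \<eta>(1)[of e] unfolding \<delta>_def by auto
  qed
  ultimately show ?thesis unfolding solves_def by blast
qed

lemma small_solves:
  assumes adm: "admissible k W E s t \<gamma> a b Z" and W: "\<And>x y. x \<in> W \<Longrightarrow> y \<in> W \<Longrightarrow> x = y"
  shows "\<exists>\<epsilon>. solves (4*k+2) W E s t \<gamma> \<epsilon>"
proof -
  note D = admissibleD[OF adm]
  have "s e = t e" if "e \<in> E" for e using W D(3,4)[OF that] by blast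
  then have "net E s t (\<lambda>_. 1) A = 0" for A unfolding net_def by simp
  moreover have "4*k+2 dvd \<gamma> x" if "x \<in> W" for x
  proof -
    have "W = {x}" using W that by blast
    then show ?thesis using D(7) by simp
  qed
  ultimately have "solves (4*k+2) W E s t \<gamma> (\<lambda>_. 1)" unfolding solves_def by simp
  then show ?thesis by blast
qed

section \<open>Steps of the induction\<close>

text \<open>Contracting \<open>A\<close> removes at least one vertex, so the induction hypothesis
  applies. The edge set is kept; edges inside \<open>A\<close> become loops and receive signs
  without effect on \<open>A\<close> as a whole or on vertices outside it.\<close>

lemma contract_step:
  fixes s t :: "'e \<Rightarrow> 'v"
  assumes adm: "admissible k W E s t \<gamma> a b Z"
    and IH: "\<forall>W' (E' :: 'e set) (s' :: 'e \<Rightarrow> 'v) t' \<gamma>' a' b' Z'. admissible k W' E' s' t' \<gamma>' a' b' Z' \<longrightarrow>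
      card W' + card E' < card W + card E \<longrightarrow> (\<exists>\<epsilon>. solves (4*k+2) W' E' s' t' \<gamma>' \<epsilon>)"
    and A: "A \<subseteq> W" "r \<in> A" "q \<in> A" "q \<noteq> r"
  obtains \<epsilon> where "\<forall>e\<in>E. \<epsilon> e = 1 \<or> \<epsilon> e = -1" "4*k+2 dvd net E s t \<epsilon> A - sum \<gamma> A"
    "\<And>v. v \<in> W - A \<Longrightarrow> 4*k+2 dvd net E s t \<epsilon> {v} - \<gamma> v"
proof -
  note D = admissibleD[OF adm]
  let ?W = "insert r (W - A)"
  have "?W \<subset> W" using A by auto
  then have "card ?W < card W" using D(1) psubset_card_mono by blast
  then obtain \<epsilon> where \<epsilon>: "solves (4*k+2) ?W E ((\<lambda>v. if v \<in> A then r else v) \<circ> s) ((\<lambda>v. if v \<in> A then r else v) \<circ> t)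
      (\<lambda>v. if v = r then sum \<gamma> A else \<gamma> v) \<epsilon>"
    using IH[rule_format, OF contract_admissible[OF adm A]] by auto
  note cn = contract_net[of E s W t r A, OF _ A(2)]
  show thesis
  proof (rule that[of \<epsilon>])
    show "\<forall>e\<in>E. \<epsilon> e = 1 \<or> \<epsilon> e = -1" using \<epsilon> unfolding solves_def by blast
    show "4*k+2 dvd net E s t \<epsilon> A - sum \<gamma> A"
      using \<epsilon> cn[of r \<epsilon>] D(3,4) unfolding solves_def by auto
    show "4*k+2 dvd net E s t \<epsilon> {v} - \<gamma> v" if "v \<in> W - A" for v
    proof -
      have "v \<noteq> r" using that A by auto
      moreover have "4*k+2 dvd net E ((\<lambda>v. if v \<in> A then r else v) \<circ> s) ((\<lambda>v. if v \<in> A then r else v) \<circ> t) \<epsilon> {v}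
          - (if v = r then sum \<gamma> A else \<gamma> v)"
        using \<epsilon> that unfolding solves_def by blast
      ultimately show ?thesis using cn[of v \<epsilon>] D(3,4) that by simp
    qed
  qed
qed

text \<open>Solving the contraction of \<open>A\<close> orients the edges leaving \<open>A\<close>.
  Tightness makes the graph inside \<open>A\<close>, with these edges preoriented, admissible again,
  and \<open>A \<noteq> W\<close> makes it smaller. The two solutions are glued along
  \<open>?E\<close>.\<close>

lemma tight_step:
  fixes s t :: "'e \<Rightarrow> 'v"
  assumes adm: "admissible k W E s t \<gamma> a b Z" and k: "k \<ge> 1"
    and IH: "\<forall>W' (E' :: 'e set) (s' :: 'e \<Rightarrow> 'v) t' \<gamma>' a' b' Z'. admissible k W' E' s' t' \<gamma>' a' b' Z' \<longrightarrow>
      card W' + card E' < card W + card E \<longrightarrow> (\<exists>\<epsilon>. solves (4*k+2) W' E' s' t' \<gamma>' \<epsilon>)"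
    and A: "A \<subseteq> W" "A \<noteq> W" "r \<in> A" "q \<in> A" "q \<noteq> r"
    and tight: "load E s t a b A \<le> 4*k + cdist (4*k+2) (demand \<gamma> a b A)"
  shows "\<exists>\<epsilon>. solves (4*k+2) W E s t \<gamma> \<epsilon>"
proof -
  note D = admissibleD[OF adm]
  obtain \<epsilon> where \<epsilon>: "\<forall>e\<in>E. \<epsilon> e = 1 \<or> \<epsilon> e = -1" "4*k+2 dvd net E s t \<epsilon> A - sum \<gamma> A"
    "\<And>v. v \<in> W - A \<Longrightarrow> 4*k+2 dvd net E s t \<epsilon> {v} - \<gamma> v"
    using contract_step[OF adm IH A(1,3-5)] by blast
  let ?E = "{e\<in>E. s e \<in> A \<and> t e \<in> A}"
  let ?g = "\<lambda>x. \<gamma> x - net (E - ?E) s t \<epsilon> {x}"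
  have "card A < card W" using A(1,2) D(1) psubset_card_mono by blast
  moreover have "card ?E \<le> card E" using D(2) by (intro card_mono) auto
  ultimately obtain \<epsilon>' where \<epsilon>': "solves (4*k+2) A ?E s t ?g \<epsilon>'"
    using restrict_admissible[OF adm A(1) tight \<epsilon>(1,2)] IH[rule_format, of A ?E s t ?g] by fastforce
  let ?d = "\<lambda>e. if e \<in> ?E then \<epsilon>' e else \<epsilon> e"
  have net: "net E s t ?d B = net (E - ?E) s t \<epsilon> B + net ?E s t \<epsilon>' B" for B
  proof -
    have "net (E - ?E) s t ?d B = net (E - ?E) s t \<epsilon> B" by (rule net_cong) auto
    moreover have "net ?E s t ?d B = net ?E s t \<epsilon>' B" by (rule net_cong) auto
    ultimately show ?thesis using net_diff[of E ?E s t ?d B] D(2) by auto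
  qed
  have "4*k+2 dvd net E s t ?d {v} - \<gamma> v" if v: "v \<in> W" for v
  proof (cases "v \<in> A")
    case True
    then have "4*k+2 dvd net ?E s t \<epsilon>' {v} - ?g v" using \<epsilon>' unfolding solves_def by blast
    then show ?thesis unfolding net by (simp add: algebra_simps)
  next
    case False
    then have "net ?E s t \<epsilon>' {v} = 0" "net ?E s t \<epsilon> {v} = 0" unfolding net_def by (auto intro!: sum.neutral)
    then have "net E s t ?d {v} = net E s t \<epsilon> {v}"
      unfolding net using net_diff[of E ?E s t \<epsilon> "{v}"] D(2) by auto
    then show ?thesis using \<epsilon>(3)[of v] v False by simp
  qed
  moreover have "\<forall>e\<in>E. ?d e = 1 \<or> ?d e = -1" using \<epsilon>(1) \<epsilon>' unfolding solves_def by auto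
  ultimately have "solves (4*k+2) W E s t \<gamma> ?d" unfolding solves_def by blast
  then show ?thesis by blast
qed

text \<open>If \<open>x\<close> has two distinct neighbours in \<open>W\<close>, a pair of edges is
  lifted. Otherwise all its edges lead to one vertex \<open>y\<close>; then \<open>{x, y}\<close> is
  contracted and the edges between \<open>x\<close> and \<open>y\<close> are oriented
  directly.\<close>

lemma lift_step:
  fixes s t :: "'e \<Rightarrow> 'v"
  assumes adm: "admissible k W E s t \<gamma> a b Z" and k: "k \<ge> 1"
    and IH: "\<forall>W' (E' :: 'e set) (s' :: 'e \<Rightarrow> 'v) t' \<gamma>' a' b' Z'. admissible k W' E' s' t' \<gamma>' a' b' Z' \<longrightarrow>
      card W' + card E' < card W + card E \<longrightarrow> (\<exists>\<epsilon>. solves (4*k+2) W' E' s' t' \<gamma>' \<epsilon>)"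
    and Z: "Z \<subseteq> {x}" and x: "x \<in> W" "W \<noteq> {x}"
    and slack: "\<And>A. A \<subseteq> W \<Longrightarrow> A \<noteq> {} \<Longrightarrow> A \<noteq> W \<Longrightarrow> (\<And>v. A \<noteq> {v}) \<Longrightarrow>
        4*k + 2 + cdist (4*k+2) (demand \<gamma> a b A) \<le> load E s t a b A"
    and xs: "4*k+2 dvd demand \<gamma> a b {x} \<or>
        4*k + 2 + cdist (4*k+2) (demand \<gamma> a b {x}) \<le> load E s t a b {x}"
  shows "\<exists>\<epsilon>. solves (4*k+2) W E s t \<gamma> \<epsilon>"
proof (cases "\<exists>e1\<in>E. \<exists>e2\<in>E. \<exists>u w. {s e1, t e1} = {x, u} \<and> {s e2, t e2} = {x, w} \<and> u \<noteq> x \<and> w \<noteq> x \<and> u \<noteq> w")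
  case True
  note D = admissibleD[OF adm]
  from True obtain e1 e2 u w where e: "e1 \<in> E" "e2 \<in> E" "{s e1, t e1} = {x, u}" "{s e2, t e2} = {x, w}"
    "u \<noteq> x" "w \<noteq> x" "u \<noteq> w" by blast
  have ne: "e1 \<noteq> e2" using e by (auto simp: doubleton_eq_iff)
  have "card (E - {e2}) < card E" using card_Diff1_less[OF D(2) e(2)] .
  then obtain \<epsilon> where "solves (4*k+2) W (E - {e2}) (s(e1 := u)) (t(e1 := w)) \<gamma> \<epsilon>"
    using lift_admissible[OF adm Z x(1) e(1,2) ne e(3-7) slack xs] IH by fastforce
  then show ?thesis using lift_solves[OF D(2) e(1,2) ne e(3-7)] by blast
next
  case False
  note D = admissibleD[OF adm]
  \<comment> \<open>When \<open>x\<close> has no edge to another vertex of \<open>W\<close>, any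
    other vertex serves as \<open>y\<close>.\<close>
  have "\<exists>y\<in>W. y \<noteq> x \<and> (\<forall>e\<in>E. \<forall>u. {s e, t e} = {x, u} \<longrightarrow> u \<noteq> x \<longrightarrow> u = y)"
  proof (cases "\<exists>e\<in>E. \<exists>u. {s e, t e} = {x, u} \<and> u \<noteq> x")
    case True
    then obtain e u where u: "e \<in> E" "{s e, t e} = {x, u}" "u \<noteq> x" by blast
    moreover have "u \<in> W" using u D(3,4)[OF u(1)] by (auto simp: doubleton_eq_iff)
    ultimately show ?thesis using False by (intro bexI[of _ u]) blast+
  next
    case False
    then show ?thesis using x by blast
  qed
  then obtain y where y: "y \<in> W" "y \<noteq> x"
    and pend: "\<And>e u. e \<in> E \<Longrightarrow> {s e, t e} = {x, u} \<Longrightarrow> u \<noteq> x \<Longrightarrow> u = y" by blast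
  let ?n = "cut_size E s t {x}"
  have "4*k + cdist (4*k+2) (demand \<gamma> a b (W - {x})) \<le> load E s t a b (W - {x})"
    using D(10)[of "W - {x}"] x y Z by blast
  then have n: "load E s t a b {x} \<le> cdist (4*k+2) (demand \<gamma> a b {x}) + 2 * ?n"
    using admissible_cut_bound[OF adm k, of "{x}"] x by simp
  \<comment> \<open>With demand \<open>0\<close>, \<open>n\<close> bounds the number
    \<open>a x + b x\<close> of preoriented edges by \<open>?n\<close>, and
    \<open>\<gamma> x\<close> is congruent to \<open>a x - b x\<close>. With slack \<open>2\<close>,
    it gives \<open>?n \<ge> 2*k+1\<close>, which is at least any value of
    \<open>cdist (4*k+2)\<close>.\<close>
  have "cdist (4*k+2) (\<gamma> x) \<le> ?n"
    using xs
  proof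
    assume z: "4*k+2 dvd demand \<gamma> a b {x}"
    then have "cdist (4*k+2) (demand \<gamma> a b {x}) = 0" using cdist_eq_0_iff[of "4*k+2"] k by simp
    then have "a x + b x \<le> ?n" using n unfolding load_single by simp
    moreover have "cdist (4*k+2) (\<gamma> x) \<le> \<bar>a x - b x\<bar>"
      using z k by (intro cdist_le_rep) (simp_all add: algebra_simps)
    ultimately show ?thesis using D(5,6)[OF x(1)] by linarith
  next
    assume "4*k + 2 + cdist (4*k+2) (demand \<gamma> a b {x}) \<le> load E s t a b {x}"
    then have "4*k+2 \<le> 2 * ?n" using n by simp
    then show ?thesis using cdist_le_half[of "4*k+2" "\<gamma> x"] k by linarith
  qed
  moreover have "even (?n + \<gamma> x)" using D(8)[of "{x}"] x unfolding load_single by simp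
  moreover obtain \<epsilon> where \<epsilon>: "\<forall>e\<in>E. \<epsilon> e = 1 \<or> \<epsilon> e = -1" "4*k+2 dvd net E s t \<epsilon> {x, y} - sum \<gamma> {x, y}"
    "\<And>v. v \<in> W - {x, y} \<Longrightarrow> 4*k+2 dvd net E s t \<epsilon> {v} - \<gamma> v"
    using contract_step[OF adm IH, of "{x, y}" y x] x y by blast
  ultimately show ?thesis
    using pendant_solves[of E s W t "4*k+2" x y \<gamma> \<epsilon>] D(2,3,4) k x y pend by simp
qed

lemma positive_step:
  fixes s t :: "'e \<Rightarrow> 'v"
  assumes adm: "admissible k W E s t \<gamma> a b {}" and k: "k \<ge> 1"
    and IH: "\<forall>W' (E' :: 'e set) (s' :: 'e \<Rightarrow> 'v) t' \<gamma>' a' b' Z'. admissible k W' E' s' t' \<gamma>' a' b' Z' \<longrightarrow>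
      card W' + card E' < card W + card E \<or>
      card W' + card E' = card W + card E \<and> (\<Sum>v\<in>W'. a' v + b' v) < (\<Sum>v\<in>W. a v + b v) \<longrightarrow>
      (\<exists>\<epsilon>. solves (4*k+2) W' E' s' t' \<gamma>' \<epsilon>)"
    and x: "x \<in> W" "W \<noteq> {x}"
    and slack: "\<And>A. A \<subseteq> W \<Longrightarrow> A \<noteq> {} \<Longrightarrow> A \<noteq> W \<Longrightarrow> (\<And>v. A \<noteq> {v}) \<Longrightarrow>
        4*k + 2 + cdist (4*k+2) (demand \<gamma> a b A) \<le> load E s t a b A"
    and pos: "\<And>v. v \<in> W \<Longrightarrow> 0 < cdist (4*k+2) (demand \<gamma> a b {v})"
      "\<And>v. v \<in> W \<Longrightarrow> 4*k+2 dvd demand \<gamma> a b {v} - cdist (4*k+2) (demand \<gamma> a b {v})"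
  shows "\<exists>\<epsilon>. solves (4*k+2) W E s t \<gamma> \<epsilon>"
proof -
  note D = admissibleD[OF adm]
  let ?M = "4*k+2"
  let ?d = "\<lambda>v. cdist ?M (demand \<gamma> a b {v})"
  have M: "?M > 0" using k by simp
  have minus1: "cdist ?M (demand \<gamma> a b {v} - 1) < ?d v" if "v \<in> W" for v
  proof -
    have "cdist ?M (demand \<gamma> a b {v} - 1) \<le> \<bar>?d v - 1\<bar>"
      using pos(2)[OF that] by (intro cdist_le_rep[OF M]) (simp add: algebra_simps)
    then show ?thesis using pos(1)[OF that] by simp
  qed
  show ?thesis
  proof (cases "\<exists>v\<in>W. b v > 0")
    case True
    then obtain v where v: "v \<in> W" "b v > 0" by blast
    \<comment> \<open>Vertices and edges stay the same, so the second component of the measure, the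
      number of preoriented edges, must drop.\<close>
    have "(\<Sum>u\<in>W. a u + (b(v := b v - 1)) u) < (\<Sum>u\<in>W. a u + b u)"
      using v D(1) by (intro sum_strict_mono_ex1) auto
    then show ?thesis
      using IH[rule_format, OF decrease_admissible[OF adm k v slack minus1[OF v(1)]]] by blast
  next
    case False
    then have b0: "b v = 0" if "v \<in> W" for v using D(6)[OF that] that by force
    define d where "d = sum a W"
    have d0: "d \<ge> 0" unfolding d_def using D(5) by (simp add: sum_nonneg)
    have loadW: "load E s t a b W = d"
      unfolding load_def d_def using admissible_split(1)[OF adm subset_refl] b0 by simp
    have "demand \<gamma> a b W = sum \<gamma> W - d"
      unfolding demand_def d_def by (simp add: sum_subtractf sum.distrib b0)
    then have demW: "?M dvd demand \<gamma> a b W - (- d)" using D(7) by simp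
    \<comment> \<open>A larger \<open>d\<close> would give total demand at distance at most
      \<open>d - (4*k+2)\<close> from the multiples of \<open>4*k+2\<close>, so the bound on
      \<open>load W\<close> would read \<open>d \<le> d - 2\<close>.\<close>
    have dle: "d \<le> 4*k+1"
    proof (rule ccontr)
      assume "\<not> d \<le> 4*k+1"
      moreover have "?M dvd demand \<gamma> a b W - (?M - d)"
      proof -
        have "demand \<gamma> a b W - (?M - d) = demand \<gamma> a b W - (- d) - ?M" by simp
        then show ?thesis using demW by (metis dvd_diff dvd_refl)
      qed
      then have "cdist ?M (demand \<gamma> a b W) \<le> \<bar>?M - d\<bar>" by (rule cdist_le_rep[OF M])
      ultimately show False using D(9) loadW by simp
    qed
    have "load E s t a b {x} \<ge> 4*k + ?d x" using D(10)[of "{x}"] x by auto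
    moreover have "load E s t a b (W - {x}) \<ge> 4*k + cdist ?M (demand \<gamma> a b (W - {x}))"
      using D(10)[of "W - {x}"] x by blast
    ultimately have "cut_size E s t {x} > 0"
      using admissible_cut_bound[OF adm k, of "{x}"] x k by simp
    moreover have "cut_size E s t {x} = 0" if "\<forall>e\<in>E. (s e = x) = (t e = x)"
      unfolding cut_size_def using that by simp
    ultimately obtain e where e: "e \<in> E" "(s e = x) \<noteq> (t e = x)" by force
    define y where "y = (if s e = x then t e else s e)"
    have y: "{s e, t e} = {x, y}" "x \<noteq> y" "y \<in> W"
      using e D(3,4)[OF e(1)] unfolding y_def by auto
    \<comment> \<open>The \<open>c\<close> new edges raise the demand of \<open>x\<close> to
      \<open>2*k+1\<close> modulo \<open>4*k+2\<close>. Deleting an edge directed into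
      \<open>x\<close> raises it once more, to \<open>2*k+2\<close>, which is congruent to
      \<open>-2*k\<close>; thus the distance falls.\<close>
    define c where "c = 2*k + 1 - ?d x"
    have c: "0 \<le> c" "c \<le> 2*k"
      using cdist_le_half[OF M, of "demand \<gamma> a b {x}"] pos(1)[OF x(1)] unfolding c_def by linarith+
    have dx: "cdist ?M (demand \<gamma> a b {x} + c + 1) < ?d x + c"
    proof -
      have "demand \<gamma> a b {x} + c + 1 - (- 2*k) = (demand \<gamma> a b {x} - ?d x) + ?M"
        unfolding c_def by simp
      then have "?M dvd demand \<gamma> a b {x} + c + 1 - (- 2*k)"
        using pos(2)[OF x(1)] by (metis dvd_add dvd_refl)
      then have "cdist ?M (demand \<gamma> a b {x} + c + 1) \<le> \<bar>- 2*k\<bar>" by (rule cdist_le_rep[OF M])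
      then show ?thesis using k unfolding c_def by simp
    qed
    \<comment> \<open>The extra vertex gets degree \<open>d + c\<close>, and the total demand
      becomes congruent to \<open>c - d\<close>. The least representative \<open>g\<close> is
      \<open>c - d\<close> or \<open>c - d + 4*k+2\<close>. In the first case the claim follows from
      \<open>2 * min c d \<le> 4*k\<close>, in the second from
      \<open>2*d \<le> 8*k+2\<close>.\<close>
    have tot: "load E s t a b W + c \<le> 4*k + cdist ?M (demand \<gamma> a b W + c)"
    proof -
      obtain g where g: "?M dvd demand \<gamma> a b W + c - g" "\<bar>g\<bar> = cdist ?M (demand \<gamma> a b W + c)"
        using cdist_rep[OF M] .
      have gle: "\<bar>g\<bar> \<le> 2*k+1" using cdist_le_half[OF M, of "demand \<gamma> a b W + c"] g(2) by linarith
      have "g - (c - d) = (demand \<gamma> a b W - (- d)) - (demand \<gamma> a b W + c - g)" by simp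
      then have "?M dvd g - (c - d)" using demW g(1) by (metis dvd_diff)
      then obtain q where q: "g - (c - d) = ?M * q" ..
      define z where "z = ?M * q"
      have gz: "g = c - d + z" using q unfolding z_def by simp
      have "q < 2"
      proof (rule ccontr)
        assume "\<not> q < 2"
        then have "?M * 2 \<le> z" unfolding z_def using M by (intro mult_left_mono) auto
        then have "8*k + 4 \<le> z" by simp
        then show False using gz gle dle c k by linarith
      qed
      moreover have "q > -1"
      proof (rule ccontr)
        assume "\<not> q > -1"
        then have "z \<le> ?M * (-1)" unfolding z_def using M by (intro mult_left_mono) auto
        then have "z \<le> - 4*k - 2" by simp
        then show False using gz gle d0 c k by linarith
      qed
      ultimately have "q = 0 \<or> q = 1" by linarith
      then have "g = c - d \<or> g = c - d + ?M" using gz unfolding z_def by auto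
      then have "d + c \<le> 4*k + \<bar>g\<bar>" using gle dle d0 c k by linarith
      then show ?thesis using g(2) loadW by simp
    qed
    note adm' = delete_admissible[OF adm k e(1) y(1,2) c(1) slack dx minus1[OF y(3)] tot]
    have "card W + card (E - {e}) < card W + card E" using card_Diff1_less[OF D(2) e(1)] by simp
    from IH[rule_format, OF adm' disjI1[OF this]]
    obtain \<epsilon> where "solves ?M W (E - {e}) s t (\<gamma>(x := \<gamma> x + 1, y := \<gamma> y - 1)) \<epsilon>" ..
    then show ?thesis by (rule delete_solves[where s = s and t = t and \<gamma> = \<gamma> and x = x and y = y, OF D(2) e(1) y(1,2)])
  qed
qed


section \<open>Case analysis for a minimal counterexample\<close>

lemma reduction_step:
  fixes s t :: "'e \<Rightarrow> 'v"
  assumes adm: "admissible k W E s t \<gamma> a b Z" and k: "k \<ge> 1"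
    and IH: "\<forall>W' (E' :: 'e set) (s' :: 'e \<Rightarrow> 'v) t' \<gamma>' a' b' Z'. admissible k W' E' s' t' \<gamma>' a' b' Z' \<longrightarrow>
      card W' + card E' < card W + card E \<or>
      card W' + card E' = card W + card E \<and> (\<Sum>v\<in>W'. a' v + b' v) < (\<Sum>v\<in>W. a v + b v) \<longrightarrow>
      (\<exists>\<epsilon>. solves (4*k+2) W' E' s' t' \<gamma>' \<epsilon>)"
  shows "\<exists>\<epsilon>. solves (4*k+2) W E s t \<gamma> \<epsilon>"
proof -
  note D = admissibleD[OF adm]
  let ?M = "4*k+2"
  let ?L = "load E s t a b"
  let ?c = "\<lambda>A. cdist ?M (demand \<gamma> a b A)"
  have M: "?M > 0" using k by simp
  have IH1: "\<forall>W' (E' :: 'e set) (s' :: 'e \<Rightarrow> 'v) t' \<gamma>' a' b' Z'. admissible k W' E' s' t' \<gamma>' a' b' Z' \<longrightarrow>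
      card W' + card E' < card W + card E \<longrightarrow> (\<exists>\<epsilon>. solves ?M W' E' s' t' \<gamma>' \<epsilon>)"
    by (intro allI impI) (rule IH[rule_format], assumption, erule disjI1)
  \<comment> \<open>Load and distance have the same parity, so a set that is not tight has slack
    \<open>2\<close>.\<close>
  have gap: "4*k + 2 + ?c A \<le> ?L A" if "A \<subseteq> W" "4*k + ?c A < ?L A" for A
  proof -
    have "even (?L A + ?c A)" using D(8)[OF that(1)] even_cdist[OF M, of "demand \<gamma> a b A"] by simp
    have "?L A \<noteq> 4*k + 1 + ?c A"
    proof
      assume "?L A = 4*k + 1 + ?c A"
      then have "?L A + ?c A = 2 * (2*k + ?c A) + 1" by simp
      then show False using \<open>even (?L A + ?c A)\<close> by simp
    qed
    then show ?thesis using that(2) by linarith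
  qed
  consider "\<And>x y. x \<in> W \<Longrightarrow> y \<in> W \<Longrightarrow> x = y"
    | A where "A \<subseteq> W" "A \<noteq> {}" "A \<noteq> W" "\<And>v. A \<noteq> {v}" "?L A \<le> 4*k + ?c A"
    | (big) x0 y0 where "x0 \<in> W" "y0 \<in> W" "x0 \<noteq> y0"
      "\<And>A. A \<subseteq> W \<Longrightarrow> A \<noteq> {} \<Longrightarrow> A \<noteq> W \<Longrightarrow> (\<And>v. A \<noteq> {v}) \<Longrightarrow> 4*k + 2 + ?c A \<le> ?L A"
  proof (cases "\<exists>A. A \<subseteq> W \<and> A \<noteq> {} \<and> A \<noteq> W \<and> (\<forall>v. A \<noteq> {v}) \<and> ?L A \<le> 4*k + ?c A")
    case True
    then show ?thesis using that(2) by blast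
  next
    case False
    then have "4*k + 2 + ?c A \<le> ?L A" if "A \<subseteq> W" "A \<noteq> {}" "A \<noteq> W" "\<And>v. A \<noteq> {v}" for A
      using gap[OF that(1)] that by (meson not_le)
    then show ?thesis using that(1,3) by blast
  qed
  then show ?thesis
  proof cases
    case 1
    then show ?thesis by (rule small_solves[OF adm])
  next
    case 2
    then obtain r q where "r \<in> A" "q \<in> A" "q \<noteq> r" by blast
    then show ?thesis using tight_step[OF adm k IH1] 2 by blast
  next
    case big
    note slack = big(4)
    have ns: "W \<noteq> {v}" for v using big by auto
    show ?thesis
    proof (cases "\<exists>x\<in>W. Z \<subseteq> {x} \<and> (?M dvd demand \<gamma> a b {x} \<or> 4*k + 2 + ?c {x} \<le> ?L {x})")
      case True
      then obtain x where "x \<in> W" "Z \<subseteq> {x}" "?M dvd demand \<gamma> a b {x} \<or> 4*k + 2 + ?c {x} \<le> ?L {x}"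
        by blast
      then show ?thesis using lift_step[OF adm k IH1 _ _ ns slack] by blast
    next
      case False
      \<comment> \<open>An exempt vertex has demand \<open>0\<close> and falls under the lifting
        case.\<close>
      then have Z: "Z = {}" using D(11) by blast
      note adm0 = adm[unfolded Z]
      have pos: "?c {v} > 0" if "v \<in> W" for v
        using False Z that cdist_nonneg[OF M, of "demand \<gamma> a b {v}"] cdist_eq_0_iff[OF M, of "demand \<gamma> a b {v}"]
        by (simp add: order_less_le)
      \<comment> \<open>The vertices with positive demand. A demand congruent to
        \<open>2*k+1\<close> has both signs and is counted as positive.\<close>
      define P where "P = {v\<in>W. ?M dvd demand \<gamma> a b {v} - ?c {v}}"
      have N: "?M dvd demand \<gamma> a b {v} + ?c {v}" if "v \<in> W - P" for v
      proof -
        obtain g where "?M dvd demand \<gamma> a b {v} - g" "\<bar>g\<bar> = ?c {v}" using cdist_rep[OF M] .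
        moreover from this have "g \<noteq> ?c {v}" using that unfolding P_def by blast
        ultimately have "g = - ?c {v}" by linarith
        then show ?thesis using \<open>?M dvd demand \<gamma> a b {v} - g\<close> by (simp only: diff_minus_eq_add)
      qed
      show ?thesis
      proof (cases "\<exists>e\<in>E. \<exists>x\<in>W - P. \<exists>y\<in>P. {s e, t e} = {x, y}")
        case True
        then obtain e x y where e: "e \<in> E" "x \<in> W - P" "y \<in> P" "{s e, t e} = {x, y}" by blast
        have "cdist ?M (demand \<gamma> a b {x} + 0 + 1) \<le> \<bar>1 - ?c {x}\<bar>"
          using N[OF e(2)] by (intro cdist_le_rep[OF M]) (simp add: algebra_simps)
        then have dx: "cdist ?M (demand \<gamma> a b {x} + 0 + 1) < ?c {x} + 0" using pos[of x] e(2) by simp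
        have "cdist ?M (demand \<gamma> a b {y} - 1) \<le> \<bar>?c {y} - 1\<bar>"
          using e(3) unfolding P_def by (intro cdist_le_rep[OF M]) (simp add: algebra_simps)
        then have dy: "cdist ?M (demand \<gamma> a b {y} - 1) < ?c {y}" using pos[of y] e(3) unfolding P_def by simp
        have xy: "x \<noteq> y" using e by auto
        have tot: "?L W + 0 \<le> 4*k + cdist ?M (demand \<gamma> a b W + 0)" using D(9) by simp
        note adm' = delete_admissible[OF adm0 k e(1,4) xy order_refl slack dx dy tot]
        have "card W + card (E - {e}) < card W + card E" using card_Diff1_less[OF D(2) e(1)] by simp
        from IH1[rule_format, OF adm' this]
        obtain \<epsilon> where "solves ?M W (E - {e}) s t (\<gamma>(x := \<gamma> x + 1, y := \<gamma> y - 1)) \<epsilon>" ..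
        then show ?thesis by (rule delete_solves[where s = s and t = t and \<gamma> = \<gamma> and x = x and y = y, OF D(2) e(1,4) xy])
      next
        case False
        \<comment> \<open>Otherwise no edge leaves \<open>P\<close>, although the degree conditions
          of \<open>P\<close> and \<open>W - P\<close> force at least \<open>2k\<close> edges
          between them.\<close>
        have "P = {} \<or> P = W"
        proof (rule ccontr)
          assume P: "\<not> (P = {} \<or> P = W)"
          have PW: "P \<subseteq> W" unfolding P_def by auto
          have "(s e \<in> P) = (t e \<in> P)" if "e \<in> E" for e
            using False D(3,4)[OF that] that by (metis DiffI insert_commute)
          then have "cut_size E s t P = 0" unfolding cut_size_def by simp
          moreover have "?L P \<ge> 4*k + ?c P" using D(10)[OF PW] P Z by blast
          moreover have "?L (W - P) \<ge> 4*k + ?c (W - P)" using D(10)[of "W - P"] P PW Z by blast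
          ultimately show False using admissible_cut_bound[OF adm k PW] k by simp
        qed
        then show ?thesis
        proof
          assume "P = W"
          then show ?thesis
            using positive_step[OF adm0 k IH big(1) ns slack pos] unfolding P_def by blast
        next
          assume "P = {}"
          have rl: "load E s t b a A = ?L A" for A unfolding load_def by (simp add: add.commute)
          have rd: "demand (\<lambda>x. - \<gamma> x) b a A = - demand \<gamma> a b A" for A
            unfolding demand_def by (subst sum_negf[symmetric]) (simp add: algebra_simps)
          have rc: "cdist ?M (- y) = cdist ?M y" for y using cdist_minus[OF M] .
          have swap: "(\<Sum>v\<in>W. b v + a v) = (\<Sum>v\<in>W. a v + b v)" by (simp only: add.commute)
          have "\<exists>\<epsilon>. solves ?M W E s t (\<lambda>x. - \<gamma> x) \<epsilon>"
          proof (rule positive_step[OF reverse_admissible[OF adm0 k] k IH[folded swap] big(1) ns])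
            show "4*k + 2 + cdist ?M (demand (\<lambda>x. - \<gamma> x) b a A) \<le> load E s t b a A"
              if "A \<subseteq> W" "A \<noteq> {}" "A \<noteq> W" "\<And>v. A \<noteq> {v}" for A
              using slack[OF that] unfolding rl rd rc .
            fix v assume v: "v \<in> W"
            show "0 < cdist ?M (demand (\<lambda>x. - \<gamma> x) b a {v})" unfolding rd rc using pos[OF v] .
            have "?M dvd - (demand \<gamma> a b {v} + ?c {v})" using N[of v] v \<open>P = {}\<close> by (simp only: dvd_minus_iff) simp
            then show "?M dvd demand (\<lambda>x. - \<gamma> x) b a {v} - cdist ?M (demand (\<lambda>x. - \<gamma> x) b a {v})"
              unfolding rd rc by simp
          qed
          then show ?thesis using reverse_solves by blast
        qed
      qed
    qed
  qed
qed

section \<open>Modulo orientations\<close>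

text \<open>Lexicographic induction, first on the number of vertices and edges, then on the number
  of preoriented edges. The latter may grow in a step that lowers the former.\<close>

theorem admissible_solvable:
  fixes W :: "'v set" and E :: "'e set"
  assumes k: "k \<ge> 1" and adm: "admissible k W E s t \<gamma> a b Z"
  shows "\<exists>\<epsilon>. solves (4*k+2) W E s t \<gamma> \<epsilon>"
  using adm
proof (induction "card W + card E" arbitrary: W E s t \<gamma> a b Z rule: less_induct)
  case outer: less
  from outer.prems outer.hyps show ?case
  proof (induction "nat (\<Sum>v\<in>W. a v + b v)" arbitrary: W E s t \<gamma> a b Z rule: less_induct)
    case less
    have nn: "(\<Sum>v\<in>W'. a' v + b' v) \<ge> 0" if "admissible k W' E' s' t' \<gamma>' a' b' Z'"
      for W' :: "'v set" and E' :: "'e set" and s' t' \<gamma>' a' b' Z'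
      using admissibleD(5,6)[OF that] by (simp add: sum_nonneg)
    show ?case
    proof (rule reduction_step[OF less.prems(1) k], intro allI impI)
      fix W' :: "'v set" and E' :: "'e set" and s' t' \<gamma>' a' b' Z'
      assume adm': "admissible k W' E' s' t' \<gamma>' a' b' Z'"
        and less': "card W' + card E' < card W + card E \<or>
          card W' + card E' = card W + card E \<and> (\<Sum>v\<in>W'. a' v + b' v) < (\<Sum>v\<in>W. a v + b v)"
      from less' show "\<exists>\<epsilon>. solves (4*k+2) W' E' s' t' \<gamma>' \<epsilon>"
      proof
        assume "card W' + card E' < card W + card E"
        then show ?thesis by (rule less.prems(2)[OF _ adm'])
      next
        assume *: "card W' + card E' = card W + card E \<and> (\<Sum>v\<in>W'. a' v + b' v) < (\<Sum>v\<in>W. a v + b v)"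
        then have "nat (\<Sum>v\<in>W'. a' v + b' v) < nat (\<Sum>v\<in>W. a v + b v)"
          using nn[OF adm'] by simp
        then show ?thesis using less.hyps[OF _ adm'] less.prems(2) * by simp
      qed
    qed
  qed
qed

section \<open>From modulus 4k+2 to modulus 2k+1\<close>

text \<open>Modulo \<open>2\<close>, the cut size of a set agrees with its net outflow in the
  reference direction, and net outflow is additive over vertices.\<close>

lemma even_cut_size_add_sum:
  assumes "finite A" "\<And>x. x \<in> A \<Longrightarrow> even (cut_size E s t {x} + f x)"
  shows "even (cut_size E s t A + sum f A)"
proof -
  have net: "even (cut_size E s t B + net E s t (\<lambda>_. 1) B)" for B
    unfolding cut_size_def net_def sum.distrib[symmetric] by (intro dvd_sum) auto
  have "even (\<Sum>x\<in>A. net E s t (\<lambda>_. 1) {x} + f x)"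
  proof (rule dvd_sum)
    fix x assume "x \<in> A"
    then show "even (net E s t (\<lambda>_. 1) {x} + f x)" using assms(2)[of x] net[of "{x}"] by simp
  qed
  then show ?thesis using net[of A] net_eq_sum[OF assms(1), of E s t "\<lambda>_. 1"] by (simp add: sum.distrib)
qed

theorem modulo_orientation:
  assumes k: "k \<ge> 1" and fin: "finite W" "finite E"
    and E: "\<And>e. e \<in> E \<Longrightarrow> s e \<in> W \<and> t e \<in> W"
    and conn: "\<And>A. A \<subseteq> W \<Longrightarrow> A \<noteq> {} \<Longrightarrow> A \<noteq> W \<Longrightarrow> 6*k \<le> cut_size E s t A"
    and bd: "2*k+1 dvd sum \<beta> W"
  shows "\<exists>\<epsilon>. solves (2*k+1) W E s t \<beta> \<epsilon>"
proof -
  \<comment> \<open>\<open>\<gamma> x\<close> is congruent to \<open>\<beta> x\<close> modulo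
    \<open>2*k+1\<close> and has the parity of the degree of \<open>x\<close>: the odd number
    \<open>2*k+1\<close> is added where the parity is wrong.\<close>
  define \<gamma> where "\<gamma> = (\<lambda>x. \<beta> x + (2*k+1) * ((\<beta> x + cut_size E s t {x}) mod 2))"
  let ?z = "\<lambda>_. 0 :: int"
  have load: "load E s t ?z ?z A = cut_size E s t A" for A unfolding load_def by simp
  have dem: "demand \<gamma> ?z ?z A = sum \<gamma> A" for A unfolding demand_def by simp
  have par1: "even (cut_size E s t {x} + \<gamma> x)" for x unfolding \<gamma>_def by (auto simp: even_iff_mod_2_eq_zero[symmetric] elim!: oddE)
  have par: "even (cut_size E s t A + sum \<gamma> A)" if "A \<subseteq> W" for A
    using even_cut_size_add_sum[of A] par1 finite_subset[OF that fin(1)] by blast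
  have \<gamma>\<beta>: "2*k+1 dvd \<gamma> x - \<beta> x" for x unfolding \<gamma>_def by simp
  have cutW: "cut_size E s t W = 0" unfolding cut_size_def using E by simp
  have "2*k+1 dvd (\<Sum>x\<in>W. \<gamma> x - \<beta> x)" using \<gamma>\<beta> by (intro dvd_sum)
  then have "2*k+1 dvd sum \<gamma> W" using bd by (simp add: sum_subtractf) (metis dvd_add_left_iff diff_add_cancel)
  moreover have "even (sum \<gamma> W)" using par[of W] cutW by simp
  moreover have "coprime (2*k+1) 2" by simp
  ultimately have "(2*k+1) * 2 dvd sum \<gamma> W" by (intro divides_mult)
  then have bd': "4*k+2 dvd sum \<gamma> W" by (simp add: algebra_simps)
  \<comment> \<open>The required bound is at most \<open>6*k+1\<close>. The one case not covered by
    \<open>6*k\<close> edges, distance \<open>2*k+1\<close> with exactly \<open>6*k\<close> edges,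
    is excluded by parity.\<close>
  have "4*k + cdist (4*k+2) (sum \<gamma> A) \<le> cut_size E s t A" if A: "A \<subseteq> W" "A \<noteq> {}" "A \<noteq> W" for A
  proof -
    have "cdist (4*k+2) (sum \<gamma> A) \<le> 2*k+1" using cdist_le_half[of "4*k+2" "sum \<gamma> A"] k by simp
    moreover have "even (cut_size E s t A + cdist (4*k+2) (sum \<gamma> A))"
      using par[OF A(1)] even_cdist[of "4*k+2" "sum \<gamma> A"] k by simp
    then have "\<not> (cut_size E s t A = 6*k \<and> cdist (4*k+2) (sum \<gamma> A) = 2*k+1)" by auto
    ultimately show ?thesis using conn[OF A] by linarith
  qed
  moreover have "0 \<le> 4*k + cdist (4*k+2) (sum \<gamma> W)" using cdist_nonneg[of "4*k+2" "sum \<gamma> W"] k by linarith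
  ultimately have "admissible k W E s t \<gamma> ?z ?z {}"
    unfolding admissible_def load dem using fin E bd' par cutW by simp
  then obtain \<epsilon> where \<epsilon>: "solves (4*k+2) W E s t \<gamma> \<epsilon>" using admissible_solvable[OF k] by blast
  have "2*k+1 dvd net E s t \<epsilon> {x} - \<beta> x" if "x \<in> W" for x
  proof -
    have "2*k+1 dvd 4*k+2" by (rule dvdI[of _ _ 2]) simp
    then have "2*k+1 dvd net E s t \<epsilon> {x} - \<gamma> x" using \<epsilon> that unfolding solves_def by (meson dvd_trans)
    from dvd_add[OF this \<gamma>\<beta>[of x]] show ?thesis by simp
  qed
  then show ?thesis using \<epsilon> unfolding solves_def by blast
qed

section \<open>Signed graphs\<close>

text \<open>Switching the vertices of \<open>X\<close> one after another flips an edge once for each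
  of its ends in \<open>X\<close>.\<close>

lemma sig_equivalent_switch_set:
  assumes "finite X" "X \<subseteq> V"
  shows "sig_equivalent V ends \<sigma> (\<lambda>e. \<sigma> e \<noteq> odd (card (ends e \<inter> X)))"
  using assms
proof (induction X rule: finite_induct)
  case empty
  then show ?case unfolding sig_equivalent_def by simp
next
  case (insert v X)
  let ?\<sigma> = "\<lambda>X e. \<sigma> e \<noteq> odd (card (ends e \<inter> X))"
  have "?\<sigma> (insert v X) = switch_at ends v (?\<sigma> X)"
    using insert.hyps unfolding switch_at_def by (auto simp: fun_eq_iff)
  then have "switch_step V ends (?\<sigma> X) (?\<sigma> (insert v X))"
    using insert.prems unfolding switch_step_def by blast
  then show ?case using insert unfolding sig_equivalent_def by (simp add: rtranclp.rtrancl_into_rtrancl)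
qed

text \<open>Exchanging the roles of in and out at \<open>v\<close> turns an orientation for the
  switched signature into one for \<open>\<sigma>\<close>, and negates the boundary at
  \<open>v\<close> only.\<close>

lemma beta_orientation_switch_at:
  assumes mg: "multigraph V E ends" and v: "v \<in> V"
    and bo: "beta_orientation m V E ends (switch_at ends v \<sigma>) (\<beta>(v := - \<beta> v)) \<tau>"
  shows "beta_orientation m V E ends \<sigma> \<beta> (\<lambda>e x. if x = v then \<not> \<tau> e x else \<tau> e x)"
proof -
  let ?t = "\<lambda>e x. if x = v then \<not> \<tau> e x else \<tau> e x"
  have two: "v \<in> ends e \<longleftrightarrow> x = v \<or> y = v" if "e \<in> E" "x \<in> ends e" "y \<in> ends e" "x \<noteq> y" for e x y
  proof -
    have "card (ends e) = 2" using mg that(1) unfolding multigraph_def by blast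
    moreover from this have "finite (ends e)" by (metis card.infinite zero_neq_numeral)
    ultimately have "{x, y} = ends e" using that(2-4) by (intro card_subset_eq) auto
    then show ?thesis by auto
  qed
  have "orientation E ends \<sigma> ?t"
    unfolding orientation_def
  proof (intro ballI impI)
    fix e x y assume e: "e \<in> E" "x \<in> ends e" "y \<in> ends e" "x \<noteq> y"
    then have "if switch_at ends v \<sigma> e then \<tau> e x = \<tau> e y else \<tau> e x \<noteq> \<tau> e y"
      using bo unfolding beta_orientation_def orientation_def by blast
    then show "if \<sigma> e then ?t e x = ?t e y else ?t e x \<noteq> ?t e y"
      using two[OF e] e(4) unfolding switch_at_def by (auto split: if_splits)
  qed
  moreover have "[int (out_deg E ends ?t x) - int (in_deg E ends ?t x) = \<beta> x] (mod m)" if "x \<in> V" for x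
  proof -
    have c: "[int (out_deg E ends \<tau> x) - int (in_deg E ends \<tau> x) = (\<beta>(v := - \<beta> v)) x] (mod m)"
      using bo that unfolding beta_orientation_def by blast
    show ?thesis
    proof (cases "x = v")
      case True
      then have "out_deg E ends ?t x = in_deg E ends \<tau> x" "in_deg E ends ?t x = out_deg E ends \<tau> x"
        unfolding out_deg_def in_deg_def by simp_all
      then show ?thesis using c True cong_minus_minus_iff[of "int (out_deg E ends \<tau> x) - int (in_deg E ends \<tau> x)" "- \<beta> v" m] by simp
    next
      case False
      then have "out_deg E ends ?t x = out_deg E ends \<tau> x" "in_deg E ends ?t x = in_deg E ends \<tau> x"
        unfolding out_deg_def in_deg_def by simp_all
      then show ?thesis using c False by simp
    qed
  qed
  ultimately show ?thesis unfolding beta_orientation_def by blast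
qed

text \<open>The claim is carried for all \<open>\<beta>\<close> at once, because each switching
  changes the prescription.\<close>

lemma beta_orientation_sig_equivalent:
  assumes mg: "multigraph V E ends" and eq: "sig_equivalent V ends \<sigma> \<sigma>'"
    and all: "\<forall>\<beta>. \<exists>\<tau>. beta_orientation m V E ends \<sigma>' \<beta> \<tau>"
  shows "\<forall>\<beta>. \<exists>\<tau>. beta_orientation m V E ends \<sigma> \<beta> \<tau>"
  using eq[unfolded sig_equivalent_def] all
proof (induction rule: converse_rtranclp_induct)
  case (step \<sigma> \<sigma>'')
  then obtain v where v: "v \<in> V" "\<sigma>'' = switch_at ends v \<sigma>" unfolding switch_step_def by blast
  show ?case
  proof
    fix \<beta>
    obtain \<tau> where "beta_orientation m V E ends (switch_at ends v \<sigma>) (\<beta>(v := - \<beta> v)) \<tau>"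
      using step.IH[OF step.prems] v(2) by blast
    then show "\<exists>\<tau>. beta_orientation m V E ends \<sigma> \<beta> \<tau>"
      using beta_orientation_switch_at[OF mg v(1)] by blast
  qed
qed

text \<open>Switching \<open>X\<close> exchanges the signs exactly on the cut. By minimality the cut
  has at most as many negative as positive edges.\<close>

lemma minimal_signature_cut:
  assumes mg: "multigraph V E ends" and conn: "edge_connected l V E ends"
    and min: "\<And>\<sigma>'. sig_equivalent V ends \<sigma> \<sigma>' \<Longrightarrow> num_negative E \<sigma> \<le> num_negative E \<sigma>'"
    and X: "X \<subseteq> V" "X \<noteq> {}" "X \<noteq> V"
  shows "l \<le> 2 * card {e\<in>E. \<not> \<sigma> e \<and> card (ends e \<inter> X) = 1}"
proof -
  have fin: "finite E" "finite X" using mg X finite_subset unfolding multigraph_def by blast+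
  have odd: "odd (card (ends e \<inter> X)) \<longleftrightarrow> card (ends e \<inter> X) = 1" if "e \<in> E" for e
  proof -
    have c: "card (ends e) = 2" using mg that unfolding multigraph_def by blast
    then have "finite (ends e)" by (metis card.infinite zero_neq_numeral)
    then have "card (ends e \<inter> X) \<le> 2" using c by (metis card_mono inf_le1)
    then show ?thesis by (auto simp: le_Suc_eq numeral_2_eq_2)
  qed
  let ?P = "{e\<in>E. \<not> \<sigma> e \<and> card (ends e \<inter> X) = 1}" and ?N = "{e\<in>E. \<sigma> e \<and> card (ends e \<inter> X) = 1}"
  let ?R = "{e\<in>E. \<sigma> e \<and> card (ends e \<inter> X) \<noteq> 1}"
  have "{e\<in>E. \<sigma> e} = ?N \<union> ?R" by auto
  then have 1: "num_negative E \<sigma> = card ?N + card ?R"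
    unfolding num_negative_def using fin by (subst card_Un_disjoint[symmetric]) auto
  have "{e\<in>E. \<sigma> e \<noteq> odd (card (ends e \<inter> X))} = ?P \<union> ?R" using odd by auto
  then have 2: "num_negative E (\<lambda>e. \<sigma> e \<noteq> odd (card (ends e \<inter> X))) = card ?P + card ?R"
    unfolding num_negative_def using fin by (subst card_Un_disjoint[symmetric]) auto
  have "edge_cut E ends X = ?P \<union> ?N" unfolding edge_cut_def by auto
  then have 3: "card (edge_cut E ends X) = card ?P + card ?N"
    using fin by (subst card_Un_disjoint[symmetric]) auto
  have "l \<le> card (edge_cut E ends X)" using conn X unfolding edge_connected_def by blast
  then show ?thesis using min[OF sig_equivalent_switch_set[OF fin(2) X(1)]] 1 2 3 by linarith
qed

section \<open>Orienting the negative, then the positive edges\<close>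

lemma out_deg_minus_in_deg:
  assumes "finite E"
  shows "int (out_deg E ends \<tau> x) - int (in_deg E ends \<tau> x)
    = (\<Sum>e\<in>E. of_bool (x \<in> ends e) * (if \<tau> e x then 1 else -1))"
proof -
  have "int (out_deg E ends \<tau> x) = (\<Sum>e\<in>E. of_bool (x \<in> ends e \<and> \<tau> e x))"
       "int (in_deg E ends \<tau> x) = (\<Sum>e\<in>E. of_bool (x \<in> ends e \<and> \<not> \<tau> e x))"
    unfolding out_deg_def in_deg_def using assms by (simp_all add: of_bool_def sum.If_cases Int_def)
  then show ?thesis by (simp only: sum_subtractf[symmetric]) (auto intro!: sum.cong)
qed

text \<open>Supplies the number \<open>g\<close> of sink edges minus source edges among
  \<open>n\<close> negative edges; they contribute \<open>2*g\<close> to the total boundary. Since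
  the least representative modulo \<open>4*k+2\<close> is at most \<open>2*k+1\<close> in absolute
  value, \<open>n \<ge> 2*k+1\<close> leaves room for it.\<close>

lemma half_residue:
  fixes k S n :: int
  assumes "k \<ge> 0" "n \<ge> 2*k+1"
  shows "\<exists>g. \<bar>g\<bar> \<le> n \<and> even (g + n) \<and> 2*k+1 dvd S - 2*g"
proof -
  let ?M = "4*k+2"
  \<comment> \<open>\<open>k+1\<close> inverts \<open>2\<close> modulo \<open>2*k+1\<close>. The
    second summand adds the odd number \<open>2*k+1\<close> where needed to match the parity of
    \<open>n\<close>.\<close>
  define r where "r = S * (k+1) + (2*k+1) * ((S * (k+1) + n) mod 2)"
  have M: "?M > 0" using assms by simp
  obtain g where g: "?M dvd r - g" "\<bar>g\<bar> = cdist ?M r" using cdist_rep[OF M] .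
  have "even ?M" by simp
  then have "even (r - g)" using g(1) dvd_trans by blast
  moreover have "even (r + n)" unfolding r_def
    by (cases "even (S * (k+1) + n)") (auto simp: even_iff_mod_2_eq_zero[symmetric] odd_iff_mod_2_eq_one)
  ultimately have "even (g + n)" by presburger
  moreover have "\<bar>g\<bar> \<le> n" using g(2) cdist_le_half[OF M, of r] assms by linarith
  moreover have "2*k+1 dvd S - 2*g"
  proof -
    have "2*k+1 dvd ?M" by (rule dvdI[of _ _ 2]) simp
    then have "2*k+1 dvd 2 * (r - g)" using g(1) dvd_trans by (metis dvd_mult)
    moreover have "S - 2*g = 2*(r - g) - (2*k+1) * (S + 2 * ((S * (k+1) + n) mod 2))"
      unfolding r_def by (simp add: algebra_simps)
    ultimately show ?thesis by (metis dvd_diff dvd_triv_left)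
  qed
  ultimately show ?thesis by blast
qed

lemma beta_orientation_of_minimal_signature:
  fixes k :: nat and V :: "'v set" and E :: "'e set" and \<beta> :: "'v \<Rightarrow> int"
  assumes k: "k \<ge> 1" and mg: "multigraph V E ends"
    and neg: "num_negative E \<sigma> \<ge> 2*k+1"
    and pos: "\<And>X. X \<subseteq> V \<Longrightarrow> X \<noteq> {} \<Longrightarrow> X \<noteq> V \<Longrightarrow> 6*k \<le> card {e\<in>E. \<not> \<sigma> e \<and> card (ends e \<inter> X) = 1}"
  shows "\<exists>\<tau>. beta_orientation (int (2*k+1)) V E ends \<sigma> \<beta> \<tau>"
proof -
  have fin: "finite V" "finite E" using mg unfolding multigraph_def by auto
  have "\<exists>p. ends e = {fst p, snd p} \<and> fst p \<noteq> snd p" if "e \<in> E" for e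
    using mg that unfolding multigraph_def by (metis card_2_iff fst_conv snd_conv)
  then obtain p where p: "\<And>e. e \<in> E \<Longrightarrow> ends e = {fst (p e), snd (p e)} \<and> fst (p e) \<noteq> snd (p e)"
    by metis
  define s where "s = (\<lambda>e. fst (p e))"
  define t where "t = (\<lambda>e. snd (p e))"
  have st: "ends e = {s e, t e}" "s e \<noteq> t e" if "e \<in> E" for e
    using p[OF that] unfolding s_def t_def by auto
  have stV: "s e \<in> V" "t e \<in> V" if "e \<in> E" for e
    using st(1)[OF that] mg that unfolding multigraph_def by auto
  let ?P = "{e\<in>E. \<not> \<sigma> e}" and ?N = "{e\<in>E. \<sigma> e}"
  let ?k = "int k"
  obtain g where g: "\<bar>g\<bar> \<le> int (card ?N)" "even (g + int (card ?N))" "2*?k+1 dvd sum \<beta> V - 2*g"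
    using half_residue[of ?k "int (card ?N)" "sum \<beta> V"] neg unfolding num_negative_def by auto
  obtain \<eta> where \<eta>: "\<And>e. \<eta> e = 1 \<or> \<eta> e = (-1::int)" "(\<Sum>e\<in>?N. \<eta> e) = g"
    using sign_sum[OF _ g(1,2)] fin by auto
  \<comment> \<open>The contribution of the negative edges to the boundary, subtracted from
    \<open>\<beta>\<close> before the positive edges are oriented.\<close>
  define h where "h = (\<lambda>x. \<Sum>e\<in>?N. \<eta> e * (of_bool (s e = x) + of_bool (t e = x)))"
  have "sum h V = (\<Sum>e\<in>?N. \<eta> e * (of_bool (s e \<in> V) + of_bool (t e \<in> V)))"
    unfolding h_def by (subst sum.swap) (simp only: sum_distrib_left[symmetric] sum.distrib sum_of_bool_eq[OF fin(1)])
  also have "\<dots> = (\<Sum>e\<in>?N. 2 * \<eta> e)" using stV by (intro sum.cong) auto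
  finally have "sum h V = 2 * g" using \<eta>(2) by (simp add: sum_distrib_left[symmetric])
  then have bd: "2*?k+1 dvd (\<Sum>x\<in>V. \<beta> x - h x)" using g(3) by (simp add: sum_subtractf)
  have "6*?k \<le> cut_size ?P s t X" if X: "X \<subseteq> V" "X \<noteq> {}" "X \<noteq> V" for X
  proof -
    have "(s e \<in> X) \<noteq> (t e \<in> X) \<longleftrightarrow> card (ends e \<inter> X) = 1" if "e \<in> E" for e
      using st[OF that] by (cases "s e \<in> X"; cases "t e \<in> X") (simp_all add: Int_insert_left)
    then have "cut_size ?P s t X = (\<Sum>e\<in>?P. of_bool (card (ends e \<inter> X) = 1))"
      unfolding cut_size_def by (intro sum.cong) auto
    also have "\<dots> = int (card {e\<in>E. \<not> \<sigma> e \<and> card (ends e \<inter> X) = 1})"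
      using fin by (simp add: of_bool_def sum.If_cases Int_def conj_assoc)
    finally show ?thesis using pos[OF X] by linarith
  qed
  then obtain \<epsilon> where \<epsilon>: "solves (2*?k+1) V ?P s t (\<lambda>x. \<beta> x - h x) \<epsilon>"
    using modulo_orientation[of ?k V ?P s t "\<lambda>x. \<beta> x - h x"] k fin stV bd by auto
  \<comment> \<open>\<open>\<eta> e = 1\<close> makes a negative edge a sink edge. A positive edge
    lies in \<open>E^+\<close> of its tail, which is \<open>s e\<close> exactly when
    \<open>\<epsilon> e = 1\<close>.\<close>
  define \<tau> where "\<tau> = (\<lambda>e x. if \<sigma> e then \<eta> e = 1 else (x = s e) = (\<epsilon> e = 1))"
  have "orientation E ends \<sigma> \<tau>"
    unfolding orientation_def \<tau>_def using st not_sym[OF st(2)] by auto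
  moreover have "[int (out_deg E ends \<tau> x) - int (in_deg E ends \<tau> x) = \<beta> x] (mod int (2*k+1))" if x: "x \<in> V" for x
  proof -
    let ?f = "\<lambda>e. of_bool (x \<in> ends e) * (if \<tau> e x then 1 else -1 :: int)"
    have "E - ?N = ?P" by auto
    then have "int (out_deg E ends \<tau> x) - int (in_deg E ends \<tau> x) = sum ?f ?P + sum ?f ?N"
      unfolding out_deg_minus_in_deg[OF fin(2)] using sum.subset_diff[of ?N E ?f] fin by auto
    also have "sum ?f ?P = net ?P s t \<epsilon> {x}"
      unfolding net_def
    proof (rule sum.cong[OF refl])
      fix e assume e: "e \<in> ?P"
      then have "\<epsilon> e = 1 \<or> \<epsilon> e = -1" using \<epsilon> unfolding solves_def by blast
      then show "?f e = \<epsilon> e * (of_bool (s e \<in> {x}) - of_bool (t e \<in> {x}))"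
        using e st[of e] unfolding \<tau>_def by auto
    qed
    also have "sum ?f ?N = h x"
      unfolding h_def
    proof (rule sum.cong[OF refl])
      fix e assume e: "e \<in> ?N"
      then show "?f e = \<eta> e * (of_bool (s e = x) + of_bool (t e = x))"
        using st[of e] \<eta>(1)[of e] unfolding \<tau>_def by auto
    qed
    finally have "int (out_deg E ends \<tau> x) - int (in_deg E ends \<tau> x) - \<beta> x = net ?P s t \<epsilon> {x} - (\<beta> x - h x)"
      by simp
    moreover have "2*?k+1 dvd net ?P s t \<epsilon> {x} - (\<beta> x - h x)" using \<epsilon> x unfolding solves_def by blast
    ultimately have "2*?k+1 dvd int (out_deg E ends \<tau> x) - int (in_deg E ends \<tau> x) - \<beta> x"
      by (simp only:)
    then show ?thesis by (simp only: cong_iff_dvd_diff of_nat_add of_nat_mult of_nat_numeral of_nat_1)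
  qed
  ultimately show ?thesis unfolding beta_orientation_def by blast
qed

theorem theorem3:
  fixes k :: nat and V :: "'v set" and E :: "'e set" and ends :: "'e \<Rightarrow> 'v set"
    and \<sigma> :: "'e \<Rightarrow> bool"
  assumes "k \<ge> 1"
    and "multigraph V E ends"
    and "unbalanced (2*k+1) V E ends \<sigma>"
    and "edge_connected (12*k-1) V E ends"
  shows "\<forall>\<beta> :: 'v \<Rightarrow> int. \<exists>\<tau>. beta_orientation (int (2*k+1)) V E ends \<sigma> \<beta> \<tau>"
proof -
  have "sig_equivalent V ends \<sigma> \<sigma>" unfolding sig_equivalent_def by simp
  then obtain \<sigma>' where eq: "sig_equivalent V ends \<sigma> \<sigma>'"
    and least: "\<And>\<sigma>''. sig_equivalent V ends \<sigma> \<sigma>'' \<Longrightarrow> num_negative E \<sigma>' \<le> num_negative E \<sigma>''"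
    using ex_has_least_nat[of "sig_equivalent V ends \<sigma>" _ "num_negative E"] by blast
  have least': "num_negative E \<sigma>' \<le> num_negative E \<sigma>''" if "sig_equivalent V ends \<sigma>' \<sigma>''" for \<sigma>''
    using least eq that unfolding sig_equivalent_def by (meson rtranclp_trans)
  \<comment> \<open>At least half of \<open>12*k-1\<close> edges, rounded up to an integer, is
    \<open>6*k\<close>.\<close>
  have "6*k \<le> card {e\<in>E. \<not> \<sigma>' e \<and> card (ends e \<inter> X) = 1}" if "X \<subseteq> V" "X \<noteq> {}" "X \<noteq> V" for X
    using minimal_signature_cut[OF assms(2,4) least' that] assms(1) by linarith
  moreover have "num_negative E \<sigma>' \<ge> 2*k+1" using assms(3) eq unfolding unbalanced_def by blast
  ultimately have "\<forall>\<beta>. \<exists>\<tau>. beta_orientation (int (2*k+1)) V E ends \<sigma>' \<beta> \<tau>"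
    using beta_orientation_of_minimal_signature[OF assms(1,2)] by blast
  then show ?thesis by (rule beta_orientation_sig_equivalent[OF assms(2) eq])
qed

end
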